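(* Maximum Weight Connected Matching can be solved in linear time (in the number of vertices) when the input graph is a tree, with arbitrary (possibly negative) real edge weights.
   Context: An edge-weighted graph is a finite simple undirected graph $G=(V,E)$ with a weight function $w:E\to\mathbb{R}$ (weights may be negative). For a matching $M\subseteq E$, let $V(M)$ be the set of endpoints of edges of $M$, $G[M]=G[V(M)]$, and $w(M)=\sum_{e\in M}w(e)$. A matching $M$ is connected if $G[M]$ is connected (the empty matching is allowed). Maximum Weight Connected Matching: given an edge-weighted graph $G$, find a connected matching $M$ of $G$ with maximum $w(M)$. *)

theory Defs
  imports Complex_Main
begin

section \<open>Graphs, trees and connected matchings\<close>

text \<open>A finite simple undirected graph is a vertex set together with a set of two-element sets of
  vertices.\<close>

definition simple_graph :: "'a set \<Rightarrow> 'a set set \<Rightarrow> bool" where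
  "simple_graph V E \<longleftrightarrow> finite V \<and> E \<subseteq> {{u, v} | u v. u \<in> V \<and> v \<in> V \<and> u \<noteq> v}"

definition adj :: "'a set set \<Rightarrow> 'a \<Rightarrow> 'a \<Rightarrow> bool" where
  "adj E u v \<longleftrightarrow> {u, v} \<in> E"

text \<open>The graph without vertices counts as connected, so that the empty matching is a connected
  matching; trees are required to be nonempty.\<close>

definition connected_graph :: "'a set \<Rightarrow> 'a set set \<Rightarrow> bool" where
  "connected_graph V E \<longleftrightarrow> (\<forall>u\<in>V. \<forall>v\<in>V. (adj E)\<^sup>*\<^sup>* u v)"

definition is_cycle :: "'a set set \<Rightarrow> 'a list \<Rightarrow> bool" where
  "is_cycle E xs \<longleftrightarrow>
     length xs \<ge> 3 \<and> distinct xs \<and> successively (adj E) xs \<and> adj E (last xs) (hd xs)"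

definition is_tree :: "'a set \<Rightarrow> 'a set set \<Rightarrow> bool" where
  "is_tree V E \<longleftrightarrow>
     simple_graph V E \<and> V \<noteq> {} \<and> connected_graph V E \<and> (\<nexists>xs. is_cycle E xs)"

definition matching :: "'a set set \<Rightarrow> 'a set set \<Rightarrow> bool" where
  "matching E M \<longleftrightarrow> M \<subseteq> E \<and> pairwise disjnt M"

definition induced_edges :: "'a set set \<Rightarrow> 'a set \<Rightarrow> 'a set set" where
  "induced_edges E X = {e \<in> E. e \<subseteq> X}"

text \<open>Here \<open>\<Union>M\<close> is the set of endpoints of the edges of \<open>M\<close>.\<close>

definition connected_matching :: "'a set set \<Rightarrow> 'a set set \<Rightarrow> bool" where
  "connected_matching E M \<longleftrightarrow>
     matching E M \<and> connected_graph (\<Union>M) (induced_edges E (\<Union>M))"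

definition max_weight_connected_matching ::
    "'a set set \<Rightarrow> ('a set \<Rightarrow> real) \<Rightarrow> 'a set set \<Rightarrow> bool" where
  "max_weight_connected_matching E w M \<longleftrightarrow>
     connected_matching E M \<and>
     (\<forall>M'. connected_matching E M' \<longrightarrow> (\<Sum>e\<in>M'. w e) \<le> (\<Sum>e\<in>M. w e))"


section \<open>The machine model\<close>

text \<open>
  Programs run on a unit-cost random access machine over the reals. The memory consists of named
  arrays, each of infinite length, of natural numbers (which serve as addresses and counters) and
  of real numbers; a program mentions only finitely many of them, and a scalar variable is cell 0
  of an array. Indirect addressing is available through nested array accesses.

  The instruction set is deliberately weak. Natural numbers can only be incremented, decremented
  (truncating at 0) and compared, so within \<open>t\<close> steps no number exceeds the largest input number
  by more than a constant (depending on the program) times \<open>t + 1\<close>: information cannot be packed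
  into large integers. Real numbers can only be added, subtracted and compared; there is no
  multiplication, rounding or conversion between the two sorts.
\<close>

type_synonym aname = string

record state =
  N :: "aname \<Rightarrow> nat \<Rightarrow> nat"
  R :: "aname \<Rightarrow> nat \<Rightarrow> real"

datatype nexp =
    NConst nat
  | NCell aname nexp
  | NInc nexp
  | NDec nexp

datatype rexp =
    RZero
  | RCell aname nexp
  | RAdd rexp rexp
  | RSub rexp rexp

datatype bexp =
    NEq nexp nexp
  | NLess nexp nexp
  | RLess rexp rexp
  | Neg bexp
  | Conj bexp bexp

datatype com =
    Skip
  | NStore aname nexp nexp
  | RStore aname nexp rexp
  | Seq com com
  | If bexp com com
  | While bexp com

primrec nval :: "nexp \<Rightarrow> state \<Rightarrow> nat" where
  "nval (NConst k) s = k"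
| "nval (NCell a i) s = N s a (nval i s)"
| "nval (NInc e) s = nval e s + 1"
| "nval (NDec e) s = nval e s - 1"

primrec rval :: "rexp \<Rightarrow> state \<Rightarrow> real" where
  "rval RZero s = 0"
| "rval (RCell a i) s = R s a (nval i s)"
| "rval (RAdd e f) s = rval e s + rval f s"
| "rval (RSub e f) s = rval e s - rval f s"

primrec bval :: "bexp \<Rightarrow> state \<Rightarrow> bool" where
  "bval (NEq e f) s \<longleftrightarrow> nval e s = nval f s"
| "bval (NLess e f) s \<longleftrightarrow> nval e s < nval f s"
| "bval (RLess e f) s \<longleftrightarrow> rval e s < rval f s"
| "bval (Neg b) s \<longleftrightarrow> \<not> bval b s"
| "bval (Conj b c) s \<longleftrightarrow> bval b s \<and> bval c s"

definition nstore :: "aname \<Rightarrow> nat \<Rightarrow> nat \<Rightarrow> state \<Rightarrow> state" where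
  "nstore a i k s = s\<lparr>N := (N s)(a := (N s a)(i := k))\<rparr>"

definition rstore :: "aname \<Rightarrow> nat \<Rightarrow> real \<Rightarrow> state \<Rightarrow> state" where
  "rstore a i x s = s\<lparr>R := (R s)(a := (R s a)(i := x))\<rparr>"

text \<open>\<open>exec p s t s'\<close>: started in \<open>s\<close>, program \<open>p\<close> terminates in \<open>s'\<close> after \<open>t\<close> steps. Every
  assignment and every evaluation of a condition costs one step; the expressions of a fixed program
  have bounded size, so charging them by size would change the running time by a constant factor
  only.\<close>

inductive exec :: "com \<Rightarrow> state \<Rightarrow> nat \<Rightarrow> state \<Rightarrow> bool" where
  Skip: "exec Skip s 1 s"
| NStore: "exec (NStore a i e) s 1 (nstore a (nval i s) (nval e s) s)"
| RStore: "exec (RStore a i e) s 1 (rstore a (nval i s) (rval e s) s)"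
| Seq: "exec p s t s' \<Longrightarrow> exec q s' t' s'' \<Longrightarrow> exec (Seq p q) s (t + t') s''"
| IfTrue: "bval b s \<Longrightarrow> exec p s t s' \<Longrightarrow> exec (If b p q) s (t + 1) s'"
| IfFalse: "\<not> bval b s \<Longrightarrow> exec q s t s' \<Longrightarrow> exec (If b p q) s (t + 1) s'"
| WhileFalse: "\<not> bval b s \<Longrightarrow> exec (While b p) s 1 s"
| WhileTrue: "bval b s \<Longrightarrow> exec p s t s' \<Longrightarrow> exec (While b p) s' t' s'' \<Longrightarrow>
    exec (While b p) s (t + t' + 1) s''"

inductive_cases SkipE: "exec Skip s t s'"
inductive_cases NStoreE: "exec (NStore a i e) s t s'"
inductive_cases RStoreE: "exec (RStore a i e) s t s'"
inductive_cases SeqE: "exec (Seq p q) s t s'"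
inductive_cases IfE: "exec (If b p q) s t s'"
inductive_cases WhileE: "exec (While b p) s t s'"

lemma exec_deterministic:
  "exec p s t s' \<Longrightarrow> exec p s u s'' \<Longrightarrow> u = t \<and> s'' = s'"
proof (induction arbitrary: u s'' rule: exec.induct)
  case (Skip s)
  then show ?case by (auto elim: SkipE)
next
  case (NStore a i e s)
  then show ?case by (auto elim: NStoreE)
next
  case (RStore a i e s)
  then show ?case by (auto elim: RStoreE)
next
  case (Seq p s t s' q t' s1)
  from Seq.prems obtain v v' r where "exec p s v r" "exec q r v' s''" "u = v + v'"
    by (auto elim: SeqE)
  with Seq.IH show ?case by metis
next
  case (IfTrue b s p t s' q)
  from IfTrue.prems IfTrue.hyps obtain v where "exec p s v s''" "u = v + 1"
    by (auto elim: IfE)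
  with IfTrue.IH show ?case by metis
next
  case (IfFalse b s q t s' p)
  from IfFalse.prems IfFalse.hyps obtain v where "exec q s v s''" "u = v + 1"
    by (auto elim: IfE)
  with IfFalse.IH show ?case by metis
next
  case (WhileFalse b s p)
  from WhileFalse.prems WhileFalse.hyps show ?case
    by (cases rule: WhileE) auto
next
  case (WhileTrue b s p t s' t' s1)
  from WhileTrue.prems WhileTrue.hyps obtain v v' r
    where "exec p s v r" "exec (While b p) r v' s''" "u = v + v' + 1"
    by (cases rule: WhileE) auto
  with WhileTrue.IH show ?case by metis
qed


section \<open>Input and output\<close>

text \<open>A graph with vertices \<open>0, \<dots>, n - 1\<close> is given as a list of its edges, in any order and each
  with its endpoints in any order, without repetition.\<close>

definition edge_of :: "'a \<times> 'a \<Rightarrow> 'a set" where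
  "edge_of uv = {fst uv, snd uv}"

definition edge_list :: "'a set set \<Rightarrow> ('a \<times> 'a) list \<Rightarrow> bool" where
  "edge_list E es \<longleftrightarrow> distinct (map edge_of es) \<and> set (map edge_of es) = E"

definition input_state :: "nat \<Rightarrow> (nat \<times> nat) list \<Rightarrow> (nat set \<Rightarrow> real) \<Rightarrow> state" where
  "input_state n es w =
     \<lparr>N = (\<lambda>_ _. 0)
        (''vertices'' := (\<lambda>_. 0)(0 := n),
         ''edges'' := (\<lambda>_. 0)(0 := length es),
         ''u'' := (\<lambda>i. if i < length es then fst (es ! i) else 0),
         ''v'' := (\<lambda>i. if i < length es then snd (es ! i) else 0)),
      R = (\<lambda>_ _. 0)
        (''w'' := (\<lambda>i. if i < length es then w (edge_of (es ! i)) else 0))\<rparr>"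

text \<open>A program answers by setting cell \<open>i\<close> of the array \<open>''out''\<close> to 1 exactly for those \<open>i\<close> for
  which the \<open>i\<close>-th edge of the input belongs to the edge set it returns.\<close>

definition output_edges :: "(nat \<times> nat) list \<Rightarrow> state \<Rightarrow> nat set set" where
  "output_edges es s = {edge_of (es ! i) | i. i < length es \<and> N s ''out'' i = 1}"

end

(* The tree is rooted by a breadth-first search. For a vertex v let P v be the larger of 0 and the best
   weight of a connected matching with topmost vertex v, and let B v be the sum of P over the children
   of v. Then P v >= B v + (w(vc) + B c - P c) for every child c, with equality for the best child if
   P v > 0. Summed over the edges of a connected matching with topmost vertex r, these inequalities
   telescope to "weight <= P r", and a top-down traceback from a maximiser of P attains equality. *)

theory Submission
  imports Defs
begin

section \<open>Trees grown edge by edge\<close>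

text \<open>The tree hypothesis speaks of connectedness and cycles, whereas a search naturally
  yields a number of edges. The purpose of \<open>grown\<close> is to turn the one into the other:
  it gives |E| = |V| - 1, so that the search tree contains every edge by cardinality, and cycles
  never meet the program. \<open>P\<close> and \<open>B\<close> suffice for this reason: if
  \<open>v\<close> is covered and the subtree of a child \<open>c\<close> contributes anything,
  connectedness forces \<open>c\<close> itself to be covered. Matching \<open>v\<close> to
  \<open>c\<close> replaces the summand P c of B v by w(vc) + B c. The change does not depend on the
  other children, so the best child is found by comparing one number per child. Cutting
  \<open>P\<close> off at 0 deals with negative weights, since a subtree may be left empty. The
  machine has no recursion, and the edges come unordered. Numbering the vertices by discovery puts
  parents before children; a counter running down then replaces the bottom-up recursion, and one
  running up the traceback. Optimality is derived from equations between \<open>P\<close>,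
  \<open>B\<close> and \<open>mate\<close> alone, independently of the program that establishes
  them.\<close>

inductive grown :: "'a set \<Rightarrow> 'a set set \<Rightarrow> bool" where
  single: "grown {a} {}"
| attach: "grown S F \<Longrightarrow> p \<in> S \<Longrightarrow> c \<notin> S \<Longrightarrow> grown (insert c S) (insert {p, c} F)"

lemma grown_edges_subset: "grown S F \<Longrightarrow> e \<in> F \<Longrightarrow> e \<subseteq> S"
  by (induction rule: grown.induct) auto

text \<open>The attached edge is new because the old edges lie inside \<open>S\<close> and
  \<open>c\<close> does not, so vertices and edges increase together. This count later forces the
  search tree to contain all edges.\<close>

lemma grown_card: "grown S F \<Longrightarrow> finite S \<and> finite F \<and> card S = Suc (card F)"
proof (induction rule: grown.induct)
  case (attach S F p c)
  then have "{p, c} \<notin> F"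
    using grown_edges_subset by blast
  with attach show ?case by simp
qed simp

lemma adj_mono: "adj F x y \<Longrightarrow> F \<subseteq> E \<Longrightarrow> adj E x y"
  by (auto simp: adj_def)

lemma adj_sym: "adj E x y \<Longrightarrow> adj E y x"
  by (simp add: adj_def insert_commute)

text \<open>The new vertex is a leaf, so only paths that start or end there have to be extended.
  Distinctness is carried along because a cycle is a list of distinct vertices.\<close>

lemma grown_path:
  "grown S F \<Longrightarrow> x \<in> S \<Longrightarrow> y \<in> S \<Longrightarrow>
    \<exists>xs. xs \<noteq> [] \<and> hd xs = x \<and> last xs = y \<and> distinct xs \<and> set xs \<subseteq> S \<and> successively (adj F) xs"
proof (induction arbitrary: x y rule: grown.induct)
  case (single a)
  then show ?case by (intro exI[of _ "[a]"]) auto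
next
  case (attach S F p c)
  have mono: "successively (adj (insert {p, c} F)) xs" if "successively (adj F) xs" for xs
    using that by (rule successively_mono) (auto simp: adj_def)
  have new: "adj (insert {p, c} F) p c" "adj (insert {p, c} F) c p"
    by (simp_all add: adj_def insert_commute)
  consider "x \<in> S" "y \<in> S" | "x \<in> S" "y = c" | "x = c" "y \<in> S" | "x = c" "y = c"
    using attach.prems by blast
  then show ?case
  proof cases
    case 1
    with attach.IH mono show ?thesis by (metis subset_insertI2)
  next
    case 2
    then obtain xs where "xs \<noteq> []" "hd xs = x" "last xs = p" "distinct xs" "set xs \<subseteq> S"
      "successively (adj F) xs"
      using attach.IH[of x p] attach.hyps by blast
    then show ?thesis
      using 2 attach.hyps
      by (intro exI[of _ "xs @ [c]"]) (auto simp: successively_append_iff mono new)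
  next
    case 3
    then obtain xs where "xs \<noteq> []" "hd xs = p" "last xs = y" "distinct xs" "set xs \<subseteq> S"
      "successively (adj F) xs"
      using attach.IH[of p y] attach.hyps by blast
    then show ?thesis
      using 3 attach.hyps
      by (intro exI[of _ "c # xs"])
        (auto simp: successively_Cons mono new)
  next
    case 4
    then show ?thesis by (intro exI[of _ "[c]"]) auto
  qed
qed

text \<open>A missing edge would close the simple path between its ends to a cycle. That path has at
  least three vertices, since a path on two vertices is the edge itself.\<close>

lemma grown_closes_cycle:
  assumes "grown S F" "F \<subseteq> E" "\<nexists>xs. is_cycle E xs" "{x, y} \<in> E" "x \<noteq> y" "x \<in> S" "y \<in> S"
  shows "{x, y} \<in> F"
proof (rule ccontr)
  assume new: "{x, y} \<notin> F"
  obtain xs where xs: "xs \<noteq> []" "hd xs = x" "last xs = y" "distinct xs" "successively (adj F) xs"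
    using grown_path[OF assms(1,6,7)] by blast
  obtain zs where zs: "xs = x # zs"
    using xs(1,2) by (cases xs) auto
  then obtain z zs' where zs': "zs = z # zs'"
    using xs(3) \<open>x \<noteq> y\<close> by (cases zs) auto
  have "zs' \<noteq> []"
    using xs zs zs' new by (auto simp: adj_def)
  then have "length xs \<ge> 3"
    using zs zs' by (cases zs') auto
  moreover have "successively (adj E) xs"
    using xs(5) by (rule successively_mono) (auto intro: adj_mono[OF _ \<open>F \<subseteq> E\<close>])
  moreover have "adj E (last xs) (hd xs)"
    using xs assms(4) by (simp add: adj_def insert_commute)
  ultimately show False
    using xs(4) assms(3) unfolding is_cycle_def by blast
qed

section \<open>Every tree is grown\<close>

lemma connected_graph_exit:
  assumes "connected_graph V E" "S \<subseteq> V" "a \<in> S" "b \<in> V - S"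
  obtains x y where "x \<in> S" "y \<notin> S" "{x, y} \<in> E"
proof -
  have "(adj E)\<^sup>*\<^sup>* a b"
    using assms unfolding connected_graph_def by blast
  moreover have "b \<notin> S"
    using assms(4) by blast
  ultimately have "\<exists>x y. x \<in> S \<and> y \<notin> S \<and> adj E x y"
  proof (induction rule: rtranclp_induct)
    case base
    with assms(3) show ?case by blast
  next
    case (step y z)
    then show ?case by blast
  qed
  then show thesis
    using that by (auto simp: adj_def)
qed

lemma simple_graph_edge:
  "simple_graph V E \<Longrightarrow> {x, y} \<in> E \<Longrightarrow> x \<in> V \<and> y \<in> V \<and> x \<noteq> y"
  unfolding simple_graph_def by (auto simp: doubleton_eq_iff)

text \<open>A grown subgraph with the most vertices is the whole tree: connectedness would otherwise
  supply an edge leaving it, and acyclicity puts every edge between its vertices into it.\<close>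

lemma tree_grown:
  assumes "is_tree V E"
  shows "grown V E"
proof -
  have sg: "simple_graph V E" and fin: "finite V" and conn: "connected_graph V E"
    and acyc: "\<nexists>xs. is_cycle E xs"
    using assms unfolding is_tree_def simple_graph_def by auto
  obtain a where a: "a \<in> V"
    using assms unfolding is_tree_def by blast
  let ?Q = "\<lambda>S. S \<subseteq> V \<and> (\<exists>F \<subseteq> E. grown S F)"
  have "\<exists>S. ?Q S \<and> (\<forall>S'. ?Q S' \<longrightarrow> card S' \<le> card S)"
  proof (rule ex_has_greatest_nat[where P = ?Q and f = card and k = "{a}" and b = "Suc (card V)"])
    show "?Q {a}"
      using a grown.single[of a] by (intro conjI exI[of _ "{}"]) auto
    show "\<forall>S. ?Q S \<longrightarrow> card S < Suc (card V)"
      using fin by (auto simp: less_Suc_eq_le intro: card_mono)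
  qed
  then obtain S F where SF: "S \<subseteq> V" "F \<subseteq> E" "grown S F"
    and max: "\<And>S'. ?Q S' \<Longrightarrow> card S' \<le> card S"
    by blast
  have finS: "finite S" and "S \<noteq> {}"
    using grown_card[OF SF(3)] by auto
  have "S = V"
  proof (rule ccontr)
    assume "S \<noteq> V"
    then obtain b where "b \<in> V - S"
      using SF(1) by blast
    with \<open>S \<noteq> {}\<close> obtain x y where xy: "x \<in> S" "y \<notin> S" "{x, y} \<in> E"
      using connected_graph_exit[OF conn SF(1)] by blast
    then have "?Q (insert y S)"
      using SF grown.attach[OF SF(3), of x y] simple_graph_edge[OF sg]
      by (intro conjI exI[of _ "insert {x, y} F"]) auto
    from max[OF this] show False
      using finS xy by simp
  qed
  moreover have "E \<subseteq> F"
  proof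
    fix e assume "e \<in> E"
    then obtain x y where e: "e = {x, y}" "x \<in> V" "y \<in> V" "x \<noteq> y"
      using sg unfolding simple_graph_def by blast
    then show "e \<in> F"
      using grown_closes_cycle[OF SF(3,2) acyc] \<open>e \<in> E\<close> \<open>S = V\<close> by simp
  qed
  ultimately show ?thesis
    using SF by auto
qed


section \<open>Connected matchings of an indexed tree\<close>

text \<open>The vertices of the tree are listed as \<open>q 0, \<dots>, q (n - 1)\<close> such that parents come
  before children, and every edge is named by the index of its lower endpoint.\<close>

locale indexed_tree =
  fixes n :: nat and q :: "nat \<Rightarrow> 'a" and par :: "nat \<Rightarrow> nat"
  assumes inj_q: "inj_on q {..<n}"
    and par_less: "i \<in> {1..<n} \<Longrightarrow> par i < i"
begin

definition ed :: "nat \<Rightarrow> 'a set" where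
  "ed i = {q i, q (par i)}"

definition cover :: "nat set \<Rightarrow> nat set" where
  "cover S = S \<union> par ` S"

text \<open>The first three conjuncts say that the edges \<open>ed i\<close> for \<open>i\<close> in
  \<open>S\<close> form a matching. The last one replaces connectedness by a condition on single
  vertices: every covered vertex but the topmost has a covered parent. The vertex \<open>r\<close>
  need not be covered, so the empty set qualifies with any \<open>r\<close>.\<close>

definition index_matching :: "nat set \<Rightarrow> nat \<Rightarrow> bool" where
  "index_matching S r \<longleftrightarrow> S \<subseteq> {1..<n} \<and> inj_on par S \<and> par ` S \<inter> S = {} \<and>
     (\<forall>v\<in>cover S. v \<noteq> r \<longrightarrow> v \<noteq> 0 \<and> par v \<in> cover S)"

lemma par_lt_n: "i \<in> {1..<n} \<Longrightarrow> par i < n"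
  using par_less[of i] by simp

lemma q_eq_iff: "i < n \<Longrightarrow> j < n \<Longrightarrow> q i = q j \<longleftrightarrow> i = j"
  using inj_q by (auto simp: inj_on_def)

text \<open>Equal edges with different lower endpoints would make each index the parent of the
  other, hence smaller than the other.\<close>

lemma inj_ed: "inj_on ed {1..<n}"
proof (rule inj_onI)
  fix i j assume ij: "i \<in> {1..<n}" "j \<in> {1..<n}" "ed i = ed j"
  then have "i = j \<or> (i = par j \<and> par i = j)"
    using par_lt_n[of i] par_lt_n[of j] unfolding ed_def doubleton_eq_iff
    by (auto simp: q_eq_iff)
  then show "i = j"
    using par_less[of i] par_less[of j] ij by auto
qed

lemma Union_ed: "\<Union> (ed ` S) = q ` cover S"
  by (auto simp: ed_def cover_def)

lemma cover_lt_n: "S \<subseteq> {1..<n} \<Longrightarrow> v \<in> cover S \<Longrightarrow> v < n"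
  using par_lt_n by (auto simp: cover_def)

lemma disjnt_ed_iff: "i \<in> {1..<n} \<Longrightarrow> j \<in> {1..<n} \<Longrightarrow>
  disjnt (ed i) (ed j) \<longleftrightarrow> i \<noteq> j \<and> par i \<noteq> par j \<and> par i \<noteq> j \<and> par j \<noteq> i"
  using par_lt_n[of i] par_lt_n[of j] by (auto simp: disjnt_def ed_def q_eq_iff)

lemma matching_ed_iff:
  assumes "S \<subseteq> {1..<n}"
  shows "matching (ed ` {1..<n}) (ed ` S) \<longleftrightarrow> inj_on par S \<and> par ` S \<inter> S = {}"
proof -
  have irrefl: "par i \<noteq> i" if "i \<in> S" for i
    using assms par_less[of i] that by auto
  have "matching (ed ` {1..<n}) (ed ` S) \<longleftrightarrow>
      (\<forall>i\<in>S. \<forall>j\<in>S. i \<noteq> j \<longrightarrow> disjnt (ed i) (ed j))"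
    using assms inj_ed
    by (auto simp: matching_def pairwise_def inj_on_eq_iff[OF inj_on_subset[OF inj_ed assms]])
  also have "\<dots> \<longleftrightarrow> (\<forall>i\<in>S. \<forall>j\<in>S. i \<noteq> j \<longrightarrow> par i \<noteq> par j \<and> par i \<noteq> j \<and> par j \<noteq> i)"
    using assms by (auto simp: disjnt_ed_iff subset_iff)
  also have "\<dots> \<longleftrightarrow> (\<forall>i\<in>S. \<forall>j\<in>S. (par i = par j \<longrightarrow> i = j) \<and> par i \<noteq> j)"
    using irrefl by metis
  also have "\<dots> \<longleftrightarrow> inj_on par S \<and> par ` S \<inter> S = {}"
    by (auto simp: inj_on_def)
  finally show ?thesis .
qed

text \<open>In a connected vertex set, everything reachable from a vertex without parent in the set lies
  below that vertex; so the vertex of least index is the only one of this kind.\<close>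

lemma connected_unique_top:
  assumes C: "C \<subseteq> {..<n}" "v \<in> C" "r \<in> C" "r \<le> v"
    and conn: "connected_graph (q ` C) (induced_edges (ed ` {1..<n}) (q ` C))"
    and top: "v = 0 \<or> par v \<notin> C"
  shows "v = r"
proof -
  define climb where "climb = (\<lambda>x y. x \<in> {1..<n} \<and> y = par x)"
  have below: "(\<exists>x\<in>C. a = q x \<and> climb\<^sup>*\<^sup>* x v)"
    if "(adj (induced_edges (ed ` {1..<n}) (q ` C)))\<^sup>*\<^sup>* (q v) a" for a
    using that
  proof (induction rule: rtranclp_induct)
    case base
    then show ?case using C by blast
  next
    case (step a b)
    then obtain x where x: "x \<in> C" "a = q x" "climb\<^sup>*\<^sup>* x v"
      by blast
    have "{a, b} \<in> ed ` {1..<n}" "{a, b} \<subseteq> q ` C"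
      using step.hyps(2) unfolding adj_def induced_edges_def by blast+
    then obtain i where i: "i \<in> {1..<n}" "{a, b} = ed i" "ed i \<subseteq> q ` C"
      by (metis imageE)
    have iC: "i \<in> C" "par i \<in> C"
      using i C(1) par_lt_n[OF i(1)] unfolding ed_def
      by (auto simp: q_eq_iff subset_iff image_iff)
    consider "a = q i" "b = q (par i)" | "a = q (par i)" "b = q i"
      using i(2) unfolding ed_def doubleton_eq_iff by blast
    then show ?case
    proof cases
      case 1
      then have "x = i"
        using x C(1) iC q_eq_iff by blast
      \<comment> \<open>The walk goes up from \<open>x\<close> to its parent, which lies in
        \<open>C\<close>; the vertex \<open>v\<close> has no such parent. So the climb from
        \<open>x\<close> to \<open>v\<close> is nonempty, and its first step can only lead to
        \<open>par i\<close>.\<close>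
      have "x \<noteq> v"
        using top iC i(1) \<open>x = i\<close> by auto
      then have "climb\<^sup>*\<^sup>* (par i) v"
        using x(3) \<open>x = i\<close> by (auto elim!: converse_rtranclpE simp: climb_def)
      then show ?thesis using 1 iC by blast
    next
      case 2
      then have "x = par i"
        using x C(1) iC q_eq_iff by blast
      then have "climb\<^sup>*\<^sup>* i v"
        using x(3) i(1) by (auto intro: converse_rtranclp_into_rtranclp simp: climb_def)
      then show ?thesis using 2 iC by blast
    qed
  qed
  \<comment> \<open>Climbing lowers the index, so a climb from \<open>r\<close> to \<open>v\<close>
    yields the inequality opposite to \<open>r \<le> v\<close>.\<close>
  have mono: "v \<le> x" if "climb\<^sup>*\<^sup>* x v" for x
    using that by (induction rule: converse_rtranclp_induct) (use par_less in \<open>force simp: climb_def\<close>)+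
  obtain x where "x \<in> C" "q r = q x" "climb\<^sup>*\<^sup>* x v"
    using below[of "q r"] conn C unfolding connected_graph_def by blast
  then show ?thesis
    using mono[of x] C q_eq_iff[of r x] by (auto simp: subset_iff)
qed

text \<open>The witness \<open>r\<close> is the least covered index, which exists because
  \<open>M\<close> is nonempty; any other covered vertex without a covered parent would coincide
  with it.\<close>

lemma connected_matching_indices:
  assumes M: "connected_matching (ed ` {1..<n}) M" "M \<noteq> {}"
  obtains S r where "M = ed ` S" "r < n" "index_matching S r"
proof -
  have "M \<subseteq> ed ` {1..<n}"
    using M(1) unfolding connected_matching_def matching_def by blast
  then obtain S where S: "S \<subseteq> {1..<n}" "M = ed ` S"
    by (auto simp: subset_image_iff)
  define r where "r = Min (cover S)"
  have fin: "finite (cover S)"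
    using S(1) by (auto simp: cover_def dest: finite_subset)
  have ne: "cover S \<noteq> {}"
    using M(2) S(2) by (auto simp: cover_def)
  have sub: "cover S \<subseteq> {..<n}"
    using cover_lt_n[OF S(1)] by blast
  have conn: "connected_graph (q ` cover S) (induced_edges (ed ` {1..<n}) (q ` cover S))"
    using M(1) unfolding connected_matching_def S(2) Union_ed by blast
  have r: "r \<in> cover S" "\<And>v. v \<in> cover S \<Longrightarrow> r \<le> v"
    using fin ne by (auto simp: r_def)
  have "v \<noteq> 0 \<and> par v \<in> cover S" if "v \<in> cover S" "v \<noteq> r" for v
    using connected_unique_top[OF sub that(1) r(1) r(2)[OF that(1)] conn] that(2) by metis
  then have "index_matching S r"
    using matching_ed_iff[OF S(1)] M(1) S unfolding index_matching_def connected_matching_def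
    by blast
  then show thesis
    using that[OF S(2)] r(1) sub by blast
qed

text \<open>From any covered vertex one can climb inside the covered set, and since indices decrease
  the climb ends at \<open>r\<close>.\<close>

lemma index_matching_connected:
  assumes S: "index_matching S r"
  shows "connected_matching (ed ` {1..<n}) (ed ` S)"
proof -
  have sub: "S \<subseteq> {1..<n}" and up: "\<And>v. v \<in> cover S \<Longrightarrow> v \<noteq> r \<Longrightarrow> v \<noteq> 0 \<and> par v \<in> cover S"
    using S unfolding index_matching_def by auto
  let ?A = "adj (induced_edges (ed ` {1..<n}) (q ` cover S))"
  have reach: "?A\<^sup>*\<^sup>* (q v) (q r)" if "v \<in> cover S" for v
    using that
  proof (induction v rule: less_induct)
    case (less v)
    show ?case
    proof (cases "v = r")
      case False
      with up less.prems have v: "v \<noteq> 0" "par v \<in> cover S"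
        by auto
      then have vn: "v \<in> {1..<n}"
        using cover_lt_n[OF sub less.prems] by simp
      then have "?A (q v) (q (par v))"
        using v less.prems by (auto simp: adj_def induced_edges_def ed_def)
      then show ?thesis
        using less.IH[OF par_less[OF vn] v(2)] by (rule converse_rtranclp_into_rtranclp)
    qed simp
  qed
  have "symp ?A"
    by (auto intro!: sympI adj_sym)
  then have "symp ?A\<^sup>*\<^sup>*"
    by (rule symp_rtranclp)
  then have "?A\<^sup>*\<^sup>* (q u) (q v)" if "u \<in> cover S" "v \<in> cover S" for u v
    using reach that by (meson rtranclp_trans sympD)
  then have "connected_graph (\<Union> (ed ` S)) (induced_edges (ed ` {1..<n}) (\<Union> (ed ` S)))"
    unfolding connected_graph_def Union_ed by blast
  then show ?thesis
    using matching_ed_iff[OF sub] S unfolding connected_matching_def index_matching_def by blast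
qed

text \<open>A covered vertex is the lower or the upper endpoint of exactly one matching edge. This
  converts sums over edges into sums over vertices, where they telescope.\<close>

lemma sum_cover:
  fixes f :: "nat \<Rightarrow> real"
  assumes "index_matching S r"
  shows "(\<Sum>v\<in>cover S. f v) = (\<Sum>i\<in>S. f i + f (par i))"
proof -
  have S: "finite S" "inj_on par S" "S \<inter> par ` S = {}"
    using assms finite_subset unfolding index_matching_def by blast+
  then show ?thesis
    by (simp add: cover_def sum.union_disjoint sum.reindex sum.distrib)
qed

end


section \<open>Optimality of the dynamic program\<close>

text \<open>\<open>P v\<close> is the larger of 0 and the best weight of a connected matching with topmost vertex
  \<open>v\<close>, and \<open>B v\<close> is the best weight that can be collected strictly below \<open>v\<close> when \<open>v\<close> is matched
  to its parent.\<close>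

locale dp_solution = indexed_tree +
  fixes wt :: "nat \<Rightarrow> real" and P B :: "nat \<Rightarrow> real" and mate :: "nat \<Rightarrow> nat" and r :: nat
  assumes P_nonneg: "v < n \<Longrightarrow> 0 \<le> P v"
    and B_eq: "v < n \<Longrightarrow> B v = (\<Sum>c | c \<in> {1..<n} \<and> par c = v. P c)"
    and P_ge: "c \<in> {1..<n} \<Longrightarrow> B (par c) + (wt c + B c - P c) \<le> P (par c)"
    and P_pos: "v < n \<Longrightarrow> 0 < P v \<Longrightarrow> mate v \<in> {1..<n} \<and> par (mate v) = v \<and>
      P v = B v + (wt (mate v) + B (mate v) - P (mate v))"
    and best: "r < n" "v < n \<Longrightarrow> P v \<le> P r"
begin

text \<open>Grouping children by their parent merges the sums behind \<open>B\<close> into one sum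
  of \<open>P\<close> over all children of covered vertices, against which the \<open>P\<close> of
  the covered vertices can be cancelled.\<close>

lemma sum_B_cover:
  assumes "S \<subseteq> {1..<n}"
  shows "(\<Sum>v\<in>cover S. B v) = (\<Sum>c | c \<in> {1..<n} \<and> par c \<in> cover S. P c)"
proof -
  have fin: "finite (cover S)"
    using assms by (auto simp: cover_def dest: finite_subset)
  have "(\<Sum>v\<in>cover S. B v) =
      (\<Sum>v\<in>cover S. sum P {c \<in> {c. c \<in> {1..<n} \<and> par c \<in> cover S}. par c = v})"
  proof (rule sum.cong[OF refl])
    fix v assume v: "v \<in> cover S"
    then have "{c \<in> {c. c \<in> {1..<n} \<and> par c \<in> cover S}. par c = v} = {c. c \<in> {1..<n} \<and> par c = v}"
      by auto
    then show "B v = sum P {c \<in> {c. c \<in> {1..<n} \<and> par c \<in> cover S}. par c = v}"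
      using B_eq cover_lt_n[OF assms v] by simp
  qed
  also have "\<dots> = sum P {c. c \<in> {1..<n} \<and> par c \<in> cover S}"
    by (rule sum.group) (use fin in auto)
  finally show ?thesis .
qed

text \<open>Summing \<open>P_ge\<close> over the edges of the matching telescopes: only the value of the topmost
  vertex is left.\<close>

lemma index_matching_weight_le:
  assumes S: "index_matching S t" and t: "t < n"
  shows "(\<Sum>i\<in>S. wt i) \<le> P t"
proof -
  have sub: "S \<subseteq> {1..<n}" and up: "\<And>v. v \<in> cover S \<Longrightarrow> v \<noteq> t \<Longrightarrow> v \<noteq> 0 \<and> par v \<in> cover S"
    using S unfolding index_matching_def by auto
  have fin: "finite (cover S)"
    using sub by (auto simp: cover_def dest: finite_subset)
  have "(\<Sum>i\<in>S. wt i) \<le> (\<Sum>i\<in>S. (P i + P (par i)) - (B i + B (par i)))"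
    using P_ge sub by (intro sum_mono) (auto simp: subset_iff algebra_simps)
  also have "\<dots> = (\<Sum>v\<in>cover S. P v) - (\<Sum>v\<in>cover S. B v)"
    by (simp only: sum_cover[OF S] sum_subtractf)
  \<comment> \<open>Equality holds if \<open>t\<close> is covered; otherwise the nonnegative summand
    \<open>P t\<close> only enlarges the bound.\<close>
  also have "(\<Sum>v\<in>cover S. P v) \<le> P t + (\<Sum>v\<in>cover S - {t}. P v)"
    using sum.remove[OF fin, of t P] P_nonneg[OF t] by (cases "t \<in> cover S") auto
  \<comment> \<open>Connectedness enters here: every covered vertex other than \<open>t\<close> is a
    child of a covered vertex. The remaining children contribute nonnegative terms.\<close>
  also have "(\<Sum>v\<in>cover S - {t}. P v) \<le> (\<Sum>v\<in>cover S. B v)"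
    unfolding sum_B_cover[OF sub]
    using up cover_lt_n[OF sub] P_nonneg by (intro sum_mono2) (auto simp: Suc_le_eq)
  finally show ?thesis by simp
qed

text \<open>The hypotheses remove each loss in the previous estimate: \<open>tight\<close> the one
  in \<open>P_ge\<close>, \<open>out\<close> the one from uncovered children. By \<open>top\<close>,
  \<open>P t\<close> occurs among the \<open>P\<close> of the covered vertices but not in the sum
  for \<open>B\<close>.\<close>

lemma index_matching_weight_eq:
  assumes S: "index_matching S t"
    and top: "t \<in> cover S" "t = 0 \<or> par t \<notin> cover S"
    and tight: "\<And>i. i \<in> S \<Longrightarrow> P (par i) = B (par i) + (wt i + B i - P i)"
    and out: "\<And>c. c \<in> {1..<n} \<Longrightarrow> par c \<in> cover S \<Longrightarrow> c \<notin> cover S \<Longrightarrow> P c = 0"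
  shows "(\<Sum>i\<in>S. wt i) = P t"
proof -
  have sub: "S \<subseteq> {1..<n}" and up: "\<And>v. v \<in> cover S \<Longrightarrow> v \<noteq> t \<Longrightarrow> v \<noteq> 0 \<and> par v \<in> cover S"
    using S unfolding index_matching_def by auto
  have fin: "finite (cover S)"
    using sub by (auto simp: cover_def dest: finite_subset)
  have "(\<Sum>i\<in>S. wt i) = (\<Sum>i\<in>S. (P i + P (par i)) - (B i + B (par i)))"
    using tight by (intro sum.cong) auto
  also have "\<dots> = (\<Sum>v\<in>cover S. P v) - (\<Sum>v\<in>cover S. B v)"
    by (simp only: sum_cover[OF S] sum_subtractf)
  also have "(\<Sum>v\<in>cover S. P v) = P t + (\<Sum>v\<in>cover S - {t}. P v)"
    using sum.remove[OF fin top(1)] .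
  also have "(\<Sum>v\<in>cover S - {t}. P v) = (\<Sum>v\<in>cover S. B v)"
    unfolding sum_B_cover[OF sub]
    using up cover_lt_n[OF sub] top out by (intro sum.mono_neutral_left) (auto simp: Suc_le_eq)
  finally show ?thesis by simp
qed

text \<open>The labels of the traceback: 0 for a vertex outside the matching, 1 for one matched to its
  child \<open>mate v\<close>, 2 for one matched to its parent.\<close>

definition traceback :: "(nat \<Rightarrow> nat) \<Rightarrow> bool" where
  "traceback st \<longleftrightarrow> (\<forall>i<n. st i =
     (if i \<noteq> 0 \<and> st (par i) = 1 \<and> mate (par i) = i then 2
      else if 0 < P i \<and> (i \<noteq> 0 \<and> st (par i) \<noteq> 0 \<or> i = r) then 1 else 0))"

text \<open>A vertex is covered exactly if its label is nonzero. A label 1 at a vertex comes with a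
  label 2 at its \<open>mate\<close>, which gives the matching; nonzero labels spread only downwards
  from \<open>r\<close>, which gives connectedness; and a child of a covered vertex gets label 0
  only if its \<open>P\<close> vanishes, which gives equality of weights.\<close>

lemma traceback_optimal:
  assumes "traceback st" and w: "\<And>i. i \<in> {1..<n} \<Longrightarrow> w (ed i) = wt i"
  shows "max_weight_connected_matching (ed ` {1..<n}) w (ed ` {i \<in> {1..<n}. st i = 2})"
proof -
  define S where "S = {i \<in> {1..<n}. st i = 2}"
  have st: "st i = (if i \<noteq> 0 \<and> st (par i) = 1 \<and> mate (par i) = i then 2
      else if 0 < P i \<and> (i \<noteq> 0 \<and> st (par i) \<noteq> 0 \<or> i = r) then 1 else 0)" if "i < n" for i
    using assms that unfolding traceback_def by blast
  have st2: "st i = 2 \<longleftrightarrow> i \<noteq> 0 \<and> st (par i) = 1 \<and> mate (par i) = i"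
    and st1: "st i = 1 \<Longrightarrow> 0 < P i"
    and st_nz: "st i \<noteq> 0 \<longleftrightarrow> i \<noteq> 0 \<and> st (par i) = 1 \<and> mate (par i) = i \<or>
      0 < P i \<and> (i \<noteq> 0 \<and> st (par i) \<noteq> 0 \<or> i = r)"
    and st_le: "st i \<in> {0, 1, 2}" if "i < n" for i
    using st[OF that] by (simp_all only: split: if_splits) auto
  have sub: "S \<subseteq> {1..<n}"
    by (auto simp: S_def)
  have inS: "i \<in> S \<longleftrightarrow> i \<in> {1..<n} \<and> st (par i) = 1 \<and> mate (par i) = i" for i
    by (cases "i < n") (auto simp only: S_def st2 mem_Collect_eq atLeastLessThan_iff)
  have one: "0 < P i \<and> mate i \<in> S \<and> par (mate i) = i" if "i < n" "st i = 1" for i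
    using st1[OF that] P_pos[OF that(1)] inS[of "mate i"] that(2) by simp
  have cover: "v \<in> cover S \<longleftrightarrow> v < n \<and> st v \<noteq> 0" for v
  proof
    assume "v \<in> cover S"
    then consider "v \<in> S" | i where "i \<in> S" "v = par i"
      unfolding cover_def by blast
    then show "v < n \<and> st v \<noteq> 0"
    proof cases
      case 1
      then show ?thesis by (simp add: S_def)
    next
      case 2
      then show ?thesis using inS[of i] par_lt_n[of i] by simp
    qed
  next
    assume v: "v < n \<and> st v \<noteq> 0"
    then consider "st v = 1" | "st v = 2"
      using st_le[of v] by auto
    then show "v \<in> cover S"
    proof cases
      case 1
      with one v show ?thesis unfolding cover_def by (metis UnCI imageI)
    next
      case 2
      then show ?thesis
        using v st2[of v] by (simp add: cover_def S_def)
    qed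
  qed
  \<comment> \<open>Any nonzero label other than that of \<open>r\<close> has a nonzero label at its
    parent, so tracing back ends at \<open>r\<close>. In particular the parent of \<open>r\<close>
    has label 0, and \<open>r\<close> is topmost.\<close>
  have ge_r: "r \<le> i" if "i < n" "st i \<noteq> 0" for i
    using that
  proof (induction i rule: less_induct)
    case (less i)
    show ?case
    proof (cases "i = r")
      case False
      then have i: "i \<in> {1..<n}" "st (par i) \<noteq> 0"
        using st_nz[of i] less.prems by auto
      then show ?thesis
        using less.IH[OF par_less[OF i(1)] par_lt_n[OF i(1)]] par_less[OF i(1)] by simp
    qed simp
  qed
  have im: "index_matching S r"
    unfolding index_matching_def
  proof (intro conjI ballI impI sub)
    show "inj_on par S"
      using inS by (metis inj_onI)
    have False if "i \<in> S" "par i \<in> S" for i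
      using inS[of i] that by (simp add: S_def)
    then show "par ` S \<inter> S = {}"
      by blast
    fix v assume v: "v \<in> cover S" "v \<noteq> r"
    then have "v \<noteq> 0 \<and> st (par v) \<noteq> 0"
      using cover[of v] st_nz[of v] by auto
    then show "v \<noteq> 0" "par v \<in> cover S"
      using v cover par_lt_n[of v] by auto
  qed
  have weight: "(\<Sum>i\<in>S. wt i) = P r"
  proof (cases "0 < P r")
    case True
    have "r = 0 \<or> st (par r) = 0"
      using ge_r[of "par r"] par_less[of r] par_lt_n[of r] best(1) by (cases "r = 0") auto
    then have "r \<in> cover S" "r = 0 \<or> par r \<notin> cover S"
      using st_nz[OF best(1)] True best(1) cover by auto
    then show ?thesis
    proof (rule index_matching_weight_eq[OF im])
      fix i assume "i \<in> S"
      then show "P (par i) = B (par i) + (wt i + B i - P i)"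
        using inS[of i] one[of "par i"] P_pos[of "par i"] par_lt_n[of i] by auto
    next
      fix c assume c: "c \<in> {1..<n}" "par c \<in> cover S" "c \<notin> cover S"
      then show "P c = 0"
        using st_nz[of c] P_nonneg[of c] cover[of c] cover[of "par c"] by auto
    qed
  next
    case False
    \<comment> \<open>If the maximum \<open>P r\<close> is not positive, no \<open>P\<close> is, so
      label 1 never occurs and nothing gets matched.\<close>
    then have "S = {}"
      using one best par_lt_n inS by (metis all_not_in_conv less_le_trans)
    then show ?thesis
      using False P_nonneg[OF best(1)] by simp
  qed
  have sum_ed: "(\<Sum>e\<in>ed ` S'. w e) = (\<Sum>i\<in>S'. wt i)"
    if "S' \<subseteq> {1..<n}" for S'
    using w that sum.reindex[OF inj_on_subset[OF inj_ed that], of w] by (auto intro!: sum.cong)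
  have "(\<Sum>e\<in>M. w e) \<le> P r"
    if M: "connected_matching (ed ` {1..<n}) M" for M
  proof (cases "M = {}")
    case True
    then show ?thesis using P_nonneg[OF best(1)] by simp
  next
    case False
    then obtain S' t where S': "M = ed ` S'" "t < n" "index_matching S' t"
      using connected_matching_indices[OF M] by blast
    then have "(\<Sum>e\<in>M. w e) = (\<Sum>i\<in>S'. wt i)"
      using sum_ed unfolding index_matching_def by blast
    also have "\<dots> \<le> P t"
      using index_matching_weight_le S' by blast
    also have "\<dots> \<le> P r"
      using best S' by blast
    finally show ?thesis .
  qed
  then show ?thesis
    using index_matching_connected[OF im] sum_ed[OF sub] weight
    unfolding max_weight_connected_matching_def S_def by simp
qed

end


section \<open>Reasoning about programs\<close>

primrec loop_free :: "com \<Rightarrow> bool" where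
  "loop_free Skip = True"
| "loop_free (NStore a i e) = True"
| "loop_free (RStore a i e) = True"
| "loop_free (Seq p q) = (loop_free p \<and> loop_free q)"
| "loop_free (If b p q) = (loop_free p \<and> loop_free q)"
| "loop_free (While b p) = False"

text \<open>The clause for \<open>While\<close> is a default value; the link with
  \<open>exec\<close> is made for loop-free programs.\<close>

primrec run :: "com \<Rightarrow> state \<Rightarrow> state" where
  "run Skip s = s"
| "run (NStore a i e) s = nstore a (nval i s) (nval e s) s"
| "run (RStore a i e) s = rstore a (nval i s) (rval e s) s"
| "run (Seq p q) s = run q (run p s)"
| "run (If b p q) s = (if bval b s then run p s else run q s)"
| "run (While b p) s = s"

text \<open>An upper bound that does not depend on the state: both branches of \<open>If\<close> are
  charged. The clause for \<open>While\<close> is a default value.\<close>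

primrec cost :: "com \<Rightarrow> nat" where
  "cost Skip = 1"
| "cost (NStore a i e) = 1"
| "cost (RStore a i e) = 1"
| "cost (Seq p q) = cost p + cost q"
| "cost (If b p q) = cost p + cost q + 1"
| "cost (While b p) = 0"

primrec nwrites :: "com \<Rightarrow> aname set" where
  "nwrites Skip = {}"
| "nwrites (NStore a i e) = {a}"
| "nwrites (RStore a i e) = {}"
| "nwrites (Seq p q) = nwrites p \<union> nwrites q"
| "nwrites (If b p q) = nwrites p \<union> nwrites q"
| "nwrites (While b p) = nwrites p"

primrec rwrites :: "com \<Rightarrow> aname set" where
  "rwrites Skip = {}"
| "rwrites (NStore a i e) = {}"
| "rwrites (RStore a i e) = {a}"
| "rwrites (Seq p q) = rwrites p \<union> rwrites q"
| "rwrites (If b p q) = rwrites p \<union> rwrites q"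
| "rwrites (While b p) = rwrites p"

lemma N_nstore [simp]: "N (nstore a i k s) b = (if b = a then (N s a)(i := k) else N s b)"
  and N_rstore [simp]: "N (rstore a i x s) = N s"
  and R_nstore [simp]: "R (nstore a i k s) = R s"
  and R_rstore [simp]: "R (rstore a i x s) b = (if b = a then (R s a)(i := x) else R s b)"
  by (simp_all add: nstore_def rstore_def)

text \<open>A syntactic approximation of what a program leaves alone. It keeps input arrays and
  results of earlier phases out of the loop invariants.\<close>

definition frame :: "com \<Rightarrow> state \<Rightarrow> state \<Rightarrow> bool" where
  "frame p s s' \<longleftrightarrow> (\<forall>a. a \<notin> nwrites p \<longrightarrow> N s' a = N s a) \<and> (\<forall>a. a \<notin> rwrites p \<longrightarrow> R s' a = R s a)"

lemma frame_refl: "frame p s s"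
  by (simp add: frame_def)

lemma frame_trans: "frame p s s' \<Longrightarrow> frame p s' s'' \<Longrightarrow> frame p s s''"
  by (simp add: frame_def)

lemma exec_frame: "exec p s t s' \<Longrightarrow> frame p s s'"
  by (induction rule: exec.induct) (auto simp: frame_def)

lemma exec_loop_free: "loop_free p \<Longrightarrow> \<exists>t\<le>cost p. exec p s t (run p s)"
proof (induction p arbitrary: s)
  case (Seq p q)
  then obtain t t' where "t \<le> cost p" "exec p s t (run p s)"
    "t' \<le> cost q" "exec q (run p s) t' (run q (run p s))"
    by (metis loop_free.simps(4))
  then show ?case
    by (auto intro!: exI[of _ "t + t'"] exec.Seq)
next
  case (If b p q)
  then obtain t t' where "t \<le> cost p" "exec p s t (run p s)" "t' \<le> cost q" "exec q s t' (run q s)"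
    by (metis loop_free.simps(5))
  then show ?case
    using exec.IfTrue[of b s p t "run p s" q] exec.IfFalse[of b s q t' "run q s" p]
    by (cases "bval b s") (force intro: exI[of _ "Suc t"], force intro: exI[of _ "Suc t'"])
qed (auto intro: exec.intros simp del: One_nat_def)

text \<open>One measure gives termination and running time: each round costs at most
  \<open>Suc (cost p)\<close> and lowers \<open>f\<close> by at least 1, and the final failing test
  adds 1. The step condition concerns only states that agree with \<open>s\<close> on all unwritten
  arrays.\<close>

lemma exec_while:
  assumes "loop_free p" and "I s"
    and step: "\<And>s'. frame p s s' \<Longrightarrow> I s' \<Longrightarrow> bval b s' \<Longrightarrow> I (run p s') \<and> f (run p s') < f s'"
  shows "\<exists>t s'. exec (While b p) s t s' \<and> t \<le> Suc (cost p) * f s + 1 \<and> frame p s s' \<and>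
    I s' \<and> \<not> bval b s'"
proof -
  have "\<exists>t s''. exec (While b p) s' t s'' \<and> t \<le> Suc (cost p) * f s' + 1 \<and> frame p s s'' \<and>
      I s'' \<and> \<not> bval b s''" if "frame p s s'" "I s'" for s'
    using that
  proof (induction "f s'" arbitrary: s' rule: less_induct)
    case less
    show ?case
    proof (cases "bval b s'")
      case False
      then show ?thesis
        using less.prems exec.WhileFalse by fastforce
    next
      case True
      obtain t where t: "t \<le> cost p" "exec p s' t (run p s')"
        using exec_loop_free[OF assms(1)] by blast
      have I: "I (run p s')" and dec: "f (run p s') < f s'"
        using step[OF less.prems True] by auto
      have "frame p s (run p s')"
        using frame_trans[OF less.prems(1) exec_frame[OF t(2)]] .
      from less.hyps[OF dec this I] obtain t' s'' where
        t': "exec (While b p) (run p s') t' s''" "t' \<le> Suc (cost p) * f (run p s') + 1"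
        "frame p s s''" "I s''" "\<not> bval b s''"
        by blast
      have "t + t' + 1 \<le> Suc (cost p) * Suc (f (run p s')) + 1"
        using t t' by simp
      also have "\<dots> \<le> Suc (cost p) * f s' + 1"
        using dec by (intro add_right_mono mult_left_mono) auto
      finally show ?thesis
        using exec.WhileTrue[OF True t(2) t'(1)] t' by blast
    qed
  qed
  then show ?thesis
    using assms(2) frame_refl by blast
qed

lemma exec_phase:
  assumes "loop_free p\<^sub>0" "loop_free p" and "I (run p\<^sub>0 s)"
    and step: "\<And>s'. frame p (run p\<^sub>0 s) s' \<Longrightarrow> I s' \<Longrightarrow> bval b s' \<Longrightarrow>
      I (run p s') \<and> f (run p s') < f s'"
    and bound: "f (run p\<^sub>0 s) \<le> k"
  shows "\<exists>t s'. exec (Seq p\<^sub>0 (While b p)) s t s' \<and> t \<le> cost p\<^sub>0 + Suc (cost p) * k + 1 \<and>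
    I s' \<and> \<not> bval b s'"
proof -
  obtain t where t: "t \<le> cost p\<^sub>0" "exec p\<^sub>0 s t (run p\<^sub>0 s)"
    using exec_loop_free[OF assms(1)] by blast
  obtain t' s' where t': "exec (While b p) (run p\<^sub>0 s) t' s'"
    "t' \<le> Suc (cost p) * f (run p\<^sub>0 s) + 1" "I s'" "\<not> bval b s'"
    using exec_while[of p I, OF assms(2,3) step] by blast
  have "Suc (cost p) * f (run p\<^sub>0 s) \<le> Suc (cost p) * k"
    using bound by (rule mult_le_mono2)
  then have "t + t' \<le> cost p\<^sub>0 + Suc (cost p) * k + 1"
    using t t' by linarith
  then show ?thesis
    using exec.Seq[OF t(2) t'(1)] t' by blast
qed

abbreviation nvar :: "aname \<Rightarrow> nexp" where
  "nvar a \<equiv> NCell a (NConst 0)"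


section \<open>Adjacency lists\<close>

text \<open>The edges incident with \<open>x\<close> form a linked list. A pointer to edge \<open>e\<close> is stored as \<open>e + 1\<close>,
  and 0 ends the list; the predecessor of \<open>k\<close> in the list of \<open>x\<close> is \<open>last_inc u v x k\<close>.\<close>

primrec last_inc :: "(nat \<Rightarrow> nat) \<Rightarrow> (nat \<Rightarrow> nat) \<Rightarrow> nat \<Rightarrow> nat \<Rightarrow> nat" where
  "last_inc u v x 0 = 0"
| "last_inc u v x (Suc k) = (if u k = x \<or> v k = x then Suc k else last_inc u v x k)"

lemma last_inc_le: "last_inc u v x k \<le> k"
  by (induction k) auto

lemma last_inc_incident:
  "last_inc u v x k \<noteq> 0 \<Longrightarrow> u (last_inc u v x k - 1) = x \<or> v (last_inc u v x k - 1) = x"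
  by (induction k) (auto split: if_splits)

lemma last_inc_gap: "last_inc u v x k \<le> e \<Longrightarrow> e < k \<Longrightarrow> u e \<noteq> x \<and> v e \<noteq> x"
  by (induction k) (auto simp: less_Suc_eq split: if_splits)

text \<open>Both old list heads are saved before either is overwritten, so the edge is prepended to
  both lists.\<close>

definition build_body :: com where
  "build_body =
    Seq (NStore ''nu'' (nvar ''k'') (NCell ''hd'' (NCell ''u'' (nvar ''k''))))
   (Seq (NStore ''nv'' (nvar ''k'') (NCell ''hd'' (NCell ''v'' (nvar ''k''))))
   (Seq (NStore ''hd'' (NCell ''u'' (nvar ''k'')) (NInc (nvar ''k'')))
   (Seq (NStore ''hd'' (NCell ''v'' (nvar ''k'')) (NInc (nvar ''k'')))
        (NStore ''k'' (NConst 0) (NInc (nvar ''k''))))))"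

definition build :: com where
  "build = Seq Skip (While (NLess (nvar ''k'') (nvar ''edges'')) build_body)"

lemma exec_build:
  assumes "N s ''hd'' = (\<lambda>_. 0)" "N s ''k'' 0 = 0" and m: "N s ''edges'' 0 = m"
    and uv: "N s ''u'' = u" "N s ''v'' = v"
  shows "\<exists>t s'. exec build s t s' \<and> t \<le> cost Skip + Suc (cost build_body) * m + 1 \<and>
    N s' ''hd'' = (\<lambda>x. last_inc u v x m) \<and>
    (\<forall>e<m. N s' ''nu'' e = last_inc u v (u e) e \<and> N s' ''nv'' e = last_inc u v (v e) e)"
proof -
  define I where "I s' \<longleftrightarrow> N s' ''k'' 0 \<le> m \<and> N s' ''hd'' = (\<lambda>x. last_inc u v x (N s' ''k'' 0)) \<and>
    (\<forall>e<N s' ''k'' 0. N s' ''nu'' e = last_inc u v (u e) e \<and> N s' ''nv'' e = last_inc u v (v e) e)"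
    for s' :: state
  have "\<exists>t s'. exec build s t s' \<and> t \<le> cost Skip + Suc (cost build_body) * m + 1 \<and>
    I s' \<and> \<not> bval (NLess (nvar ''k'') (nvar ''edges'')) s'"
    unfolding build_def
  proof (rule exec_phase[where f = "\<lambda>s'. m - N s' ''k'' 0"])
    show "I (run Skip s)"
      using assms by (auto simp: I_def)
    fix s' assume fr: "frame build_body (run Skip s) s'" and I: "I s'"
      and b: "bval (NLess (nvar ''k'') (nvar ''edges'')) s'"
    have const: "N s' ''u'' = u" "N s' ''v'' = v" "N s' ''edges'' 0 = m"
      using fr assms by (auto simp: frame_def build_body_def)
    show "I (run build_body s') \<and> m - N (run build_body s') ''k'' 0 < m - N s' ''k'' 0"
      using I b const by (auto simp: I_def build_body_def less_Suc_eq fun_eq_iff)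
  qed (auto simp: build_body_def)
  then obtain t s' where s': "exec build s t s'"
    "t \<le> cost Skip + Suc (cost build_body) * m + 1" "I s'" "N s' ''edges'' 0 \<le> N s' ''k'' 0"
    by auto
  have "N s' ''edges'' 0 = m"
    using exec_frame[OF s'(1)] m by (auto simp: frame_def build_def build_body_def)
  then have "N s' ''k'' 0 = m"
    using s'(3,4) by (simp add: I_def)
  then show ?thesis
    using s'(1-3) unfolding I_def by metis
qed


section \<open>Breadth-first search\<close>

text \<open>\<open>h x\<close> points to the unscanned rest of the adjacency list of \<open>x\<close>; the vertices found so far
  are \<open>q 0, \<dots>, q (ql - 1)\<close>, and those before \<open>qi\<close> are finished. The vertex \<open>q i\<close> was
  reached from \<open>q (par i)\<close> through the edge \<open>pe i\<close>.\<close>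

definition search_inv where
  "search_inv n m u v h q vis par pe qi ql \<longleftrightarrow>
     1 \<le> ql \<and> qi \<le> ql \<and> q 0 = 0 \<and> par 0 = (0::nat) \<and> inj_on q {..<ql} \<and> q ` {..<ql} \<subseteq> {..<n} \<and>
     (\<forall>x<n. vis x \<noteq> (0::nat) \<longleftrightarrow> x \<in> q ` {..<ql}) \<and>
     (\<forall>i\<in>{1..<ql}. par i < i \<and> pe i < m \<and> {u (pe i), v (pe i)} = {q i, q (par i)}) \<and>
     (\<forall>x. h x \<le> m \<and> (h x \<noteq> 0 \<longrightarrow> u (h x - 1) = x \<or> v (h x - 1) = x)) \<and>
     (\<forall>i<qi. h (q i) = 0) \<and>
     (\<forall>x. \<forall>e<m. h x \<le> e \<and> (u e = x \<or> v e = x) \<longrightarrow>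
       u e \<in> q ` {..<ql} \<and> v e \<in> q ` {..<(ql::nat)})"

text \<open>The incidences still to be scanned, serving as a potential for the search. The
  inequality is strict because pointers are shifted by one.\<close>

definition darts :: "(nat \<Rightarrow> nat) \<Rightarrow> (nat \<Rightarrow> nat) \<Rightarrow> (nat \<Rightarrow> nat) \<Rightarrow> (nat \<times> nat) set" where
  "darts u v h = {(x, e). e < h x \<and> (u e = x \<or> v e = x)}"

text \<open>The search starts at vertex 0, which the zero-filled array \<open>q\<close> already
  lists. The clause on scanned edges holds vacuously, since no incident edge lies beyond the head of
  a list.\<close>

lemma search_inv_init:
  assumes "0 < n" "par 0 = 0"
  shows "search_inv n m u v (\<lambda>x. last_inc u v x m) (\<lambda>_. 0) ((\<lambda>_. 0)(0 := 1)) par pe 0 1"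
  using assms last_inc_le[of u v _ m] last_inc_incident[of u v _ m] last_inc_gap[of u v _ m]
  by (auto simp: search_inv_def lessThan_Suc)

lemma darts_subset:
  assumes "\<And>x. h x \<le> m"
  shows "darts u v h \<subseteq> (\<lambda>e. (u e, e)) ` {..<m} \<union> (\<lambda>e. (v e, e)) ` {..<m}"
  using assms by (auto simp: darts_def image_iff dest: less_le_trans)

lemma finite_darts: "(\<And>x. h x \<le> m) \<Longrightarrow> finite (darts u v h)"
  by (rule finite_subset[OF darts_subset]) auto

lemma card_darts:
  assumes "\<And>x. h x \<le> m"
  shows "card (darts u v h) \<le> 2 * m"
proof -
  have "card (darts u v h) \<le> card ((\<lambda>e. (u e, e)) ` {..<m} \<union> (\<lambda>e. (v e, e)) ` {..<m})"
    using darts_subset[OF assms] by (intro card_mono) auto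
  also have "\<dots> \<le> card ((\<lambda>e. (u e, e)) ` {..<m}) + card ((\<lambda>e. (v e, e)) ` {..<m})"
    by (rule card_Un_le)
  also have "\<dots> \<le> card {..<m} + card {..<m}"
    by (intro add_mono card_image_le) auto
  finally show ?thesis by simp
qed

text \<open>The head of the list of \<open>x\<close> ceases to be an unscanned incidence, and moving
  a pointer down creates none.\<close>

lemma card_darts_pop:
  assumes "\<And>x. h x \<le> m" "h x \<noteq> 0" "u (h x - 1) = x \<or> v (h x - 1) = x"
  shows "card (darts u v (h(x := last_inc u v x (h x - 1)))) < card (darts u v h)"
proof (rule psubset_card_mono[OF finite_darts[OF assms(1)]])
  have le: "last_inc u v x (h x - 1) \<le> h x - 1"
    by (rule last_inc_le)
  have "darts u v (h(x := last_inc u v x (h x - 1))) \<subseteq> darts u v h"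
    using le by (auto simp: darts_def split: if_splits)
  moreover have "(x, h x - 1) \<in> darts u v h"
    using assms(2,3) by (auto simp: darts_def)
  moreover have "(x, h x - 1) \<notin> darts u v (h(x := last_inc u v x (h x - 1)))"
    using le by (auto simp: darts_def)
  ultimately show "darts u v (h(x := last_inc u v x (h x - 1))) \<subset> darts u v h"
    by blast
qed

lemma search_inv_next:
  assumes "search_inv n m u v h q vis par pe qi ql" "qi < ql" "h (q qi) = 0"
  shows "search_inv n m u v h q vis par pe (Suc qi) ql"
  using assms by (auto simp: search_inv_def less_Suc_eq)

text \<open>The edges between the new list head and \<open>e\<close> are not incident with
  \<open>x\<close>, so \<open>e\<close> is the only newly scanned edge to check, and both its ends
  have been found already.\<close>

lemma search_inv_skip:
  assumes inv: "search_inv n m u v h q vis par pe qi ql" and "qi < ql"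
    and x: "x = q qi" "h x \<noteq> 0" and e: "e = h x - 1"
    and y: "y = (if u e = x then v e else u e)" "y < n" "vis y \<noteq> 0"
  shows "search_inv n m u v (h(x := last_inc u v x e)) q vis par pe qi ql"
proof -
  let ?h = "h(x := last_inc u v x e)"
  have xX: "x \<in> q ` {..<ql}" and yX: "y \<in> q ` {..<ql}"
    using inv x y \<open>qi < ql\<close> by (auto simp: search_inv_def)
  have e_inc: "u e = x \<or> v e = x" and "e < m"
    using inv x e by (auto simp: search_inv_def Suc_le_eq dest: spec[of _ x])
  have uv: "u e \<in> q ` {..<ql} \<and> v e \<in> q ` {..<ql}"
    using e_inc xX yX y(1) by (auto split: if_splits)
  have "\<forall>z. ?h z \<le> m \<and> (?h z \<noteq> 0 \<longrightarrow> u (?h z - 1) = z \<or> v (?h z - 1) = z)"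
    using inv last_inc_le[of u v x e] last_inc_incident[of u v x e] \<open>e < m\<close>
    by (auto simp: search_inv_def)
  moreover have "\<forall>i<qi. ?h (q i) = 0"
    using inv x \<open>qi < ql\<close> by (auto simp: search_inv_def)
  moreover have "\<forall>z. \<forall>e'<m. ?h z \<le> e' \<and> (u e' = z \<or> v e' = z) \<longrightarrow>
      u e' \<in> q ` {..<ql} \<and> v e' \<in> q ` {..<ql}"
  proof (intro allI impI)
    fix z e' assume that: "e' < m" "?h z \<le> e' \<and> (u e' = z \<or> v e' = z)"
    show "u e' \<in> q ` {..<ql} \<and> v e' \<in> q ` {..<ql}"
    proof (cases "h z \<le> e'")
      case True
      then have "u e' \<in> q ` {..<ql} \<and> v e' \<in> q ` {..<ql}"
        using inv that unfolding search_inv_def by blast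
      then show ?thesis .
    next
      case False
      then have "z = x" "e' \<le> e"
        using that e by (auto split: if_splits)
      then have "e' = e"
        using last_inc_gap[of u v x e e'] that by (cases "e' = e") auto
      then show ?thesis
        using uv by simp
    qed
  qed
  ultimately show ?thesis
    using inv unfolding search_inv_def by (elim conjE) (intro conjI; assumption)
qed

text \<open>As for a skipped edge, only \<open>e\<close> is newly scanned; now its far end
  \<open>y\<close> becomes found by being appended to the queue, with the earlier position
  \<open>qi\<close> as parent.\<close>

lemma search_inv_push:
  assumes inv: "search_inv n m u v h q vis par pe qi ql" and "qi < ql"
    and x: "x = q qi" "h x \<noteq> 0" and e: "e = h x - 1"
    and y: "y = (if u e = x then v e else u e)" "y < n" "vis y = 0"
  shows "search_inv n m u v (h(x := last_inc u v x e)) (q(ql := y)) (vis(y := 1))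
    (par(ql := qi)) (pe(ql := e)) qi (Suc ql)"
proof -
  let ?h = "h(x := last_inc u v x e)" and ?q = "q(ql := y)"
  have img: "?q ` {..<Suc ql} = insert y (q ` {..<ql})"
    by (auto simp: lessThan_Suc)
  have xX: "x \<in> q ` {..<ql}" and yX: "y \<notin> q ` {..<ql}"
    using inv x y \<open>qi < ql\<close> by (auto simp: search_inv_def)
  have e_inc: "u e = x \<or> v e = x" and "e < m"
    using inv x e by (auto simp: search_inv_def Suc_le_eq dest: spec[of _ x])
  have uv: "{u e, v e} = {y, x}"
    using e_inc y(1) by auto
  have "\<forall>z. ?h z \<le> m \<and> (?h z \<noteq> 0 \<longrightarrow> u (?h z - 1) = z \<or> v (?h z - 1) = z)"
    using inv last_inc_le[of u v x e] last_inc_incident[of u v x e] \<open>e < m\<close>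
    by (auto simp: search_inv_def)
  moreover have "\<forall>i<qi. ?h (?q i) = 0"
    using inv x \<open>qi < ql\<close> by (auto simp: search_inv_def)
  moreover have "\<forall>z. \<forall>e'<m. ?h z \<le> e' \<and> (u e' = z \<or> v e' = z) \<longrightarrow>
      u e' \<in> ?q ` {..<Suc ql} \<and> v e' \<in> ?q ` {..<Suc ql}"
  proof (intro allI impI)
    fix z e' assume that: "e' < m" "?h z \<le> e' \<and> (u e' = z \<or> v e' = z)"
    show "u e' \<in> ?q ` {..<Suc ql} \<and> v e' \<in> ?q ` {..<Suc ql}"
    proof (cases "h z \<le> e'")
      case True
      then have "u e' \<in> q ` {..<ql} \<and> v e' \<in> q ` {..<ql}"
        using inv that unfolding search_inv_def by blast
      then show ?thesis
        unfolding img by blast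
    next
      case False
      then have "z = x" "e' \<le> e"
        using that e by (auto split: if_splits)
      then have "e' = e"
        using last_inc_gap[of u v x e e'] that by (cases "e' = e") auto
      then show ?thesis
        unfolding img using uv xX by (auto simp: doubleton_eq_iff)
    qed
  qed
  moreover have "inj_on ?q {..<Suc ql}"
    using inv yX by (auto simp: search_inv_def lessThan_Suc inj_on_def)
  moreover have "\<forall>i\<in>{1..<Suc ql}. (par(ql := qi)) i < i \<and> (pe(ql := e)) i < m \<and>
      {u ((pe(ql := e)) i), v ((pe(ql := e)) i)} = {?q i, ?q ((par(ql := qi)) i)}"
  proof
    fix i assume i: "i \<in> {1..<Suc ql}"
    show "(par(ql := qi)) i < i \<and> (pe(ql := e)) i < m \<and>
      {u ((pe(ql := e)) i), v ((pe(ql := e)) i)} = {?q i, ?q ((par(ql := qi)) i)}"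
    proof (cases "i = ql")
      case True
      then show ?thesis
        using \<open>qi < ql\<close> \<open>e < m\<close> uv x by simp
    next
      case False
      then have "i \<in> {1..<ql}"
        using i by simp
      then have "par i < i \<and> pe i < m \<and> {u (pe i), v (pe i)} = {q i, q (par i)}"
        using inv unfolding search_inv_def by blast
      moreover from this have "par i \<noteq> ql"
        using \<open>i \<in> {1..<ql}\<close> by auto
      ultimately show ?thesis
        using False by simp
    qed
  qed
  moreover have "\<forall>z<n. (vis(y := 1)) z \<noteq> 0 \<longleftrightarrow> z \<in> ?q ` {..<Suc ql}"
    unfolding img using inv by (simp add: search_inv_def)
  moreover have "?q ` {..<Suc ql} \<subseteq> {..<n}"
    unfolding img using inv y by (simp add: search_inv_def)
  moreover have "1 \<le> Suc ql" "qi \<le> Suc ql" "?q 0 = 0" "(par(ql := qi)) 0 = 0"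
    using inv by (simp_all add: search_inv_def)
  ultimately show ?thesis
    unfolding search_inv_def by - (intro conjI; assumption)
qed

text \<open>The scan of a list is flattened into the main loop: a round either finishes a vertex or
  pops one incidence. The body thus stays loop-free, and one potential bounds all rounds.\<close>

definition search_body :: com where
  "search_body =
    Seq (NStore ''x'' (NConst 0) (NCell ''q'' (nvar ''qi'')))
   (If (NEq (NCell ''hd'' (nvar ''x'')) (NConst 0))
     (NStore ''qi'' (NConst 0) (NInc (nvar ''qi'')))
     (Seq (NStore ''e'' (NConst 0) (NDec (NCell ''hd'' (nvar ''x''))))
     (Seq (If (NEq (NCell ''u'' (nvar ''e'')) (nvar ''x''))
       (Seq (NStore ''hd'' (nvar ''x'') (NCell ''nu'' (nvar ''e'')))
            (NStore ''y'' (NConst 0) (NCell ''v'' (nvar ''e''))))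
       (Seq (NStore ''hd'' (nvar ''x'') (NCell ''nv'' (nvar ''e'')))
            (NStore ''y'' (NConst 0) (NCell ''u'' (nvar ''e'')))))
     (If (NEq (NCell ''vis'' (nvar ''y'')) (NConst 0))
       (Seq (NStore ''vis'' (nvar ''y'') (NConst 1))
       (Seq (NStore ''q'' (nvar ''ql'') (nvar ''y''))
       (Seq (NStore ''par'' (nvar ''ql'') (nvar ''qi''))
       (Seq (NStore ''pe'' (nvar ''ql'') (nvar ''e''))
            (NStore ''ql'' (NConst 0) (NInc (nvar ''ql''))))))) Skip))))"

definition search_init :: com where
  "search_init = Seq (NStore ''vis'' (NConst 0) (NConst 1)) (NStore ''ql'' (NConst 0) (NConst 1))"

definition search :: com where
  "search = Seq search_init (While (NLess (nvar ''qi'') (nvar ''ql'')) search_body)"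

definition search_state where
  "search_state n m u v s \<longleftrightarrow> search_inv n m u v (N s ''hd'') (N s ''q'') (N s ''vis'')
     (N s ''par'') (N s ''pe'') (N s ''qi'' 0) (N s ''ql'' 0)"

lemma search_step:
  assumes I: "search_state n m u v s" and b: "N s ''qi'' 0 < N s ''ql'' 0"
    and uv: "N s ''u'' = u" "N s ''v'' = v" "\<And>e. e < m \<Longrightarrow> u e < n \<and> v e < n"
    and nx: "\<And>e. e < m \<Longrightarrow> N s ''nu'' e = last_inc u v (u e) e \<and> N s ''nv'' e = last_inc u v (v e) e"
  shows "search_state n m u v (run search_body s) \<and>
    n - N (run search_body s) ''qi'' 0 + card (darts u v (N (run search_body s) ''hd'')) <
    n - N s ''qi'' 0 + card (darts u v (N s ''hd''))"
proof -
  let ?h = "N s ''hd''" and ?qi = "N s ''qi'' 0" and ?ql = "N s ''ql'' 0"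
  define x where "x = N s ''q'' ?qi"
  define e where "e = ?h x - 1"
  define y where "y = (if u e = x then v e else u e)"
  note I' = I[unfolded search_state_def]
  have hm: "?h z \<le> m" for z
    using I' unfolding search_inv_def by blast
  \<comment> \<open>Since \<open>q\<close> lists distinct vertices, \<open>qi\<close> stays below
    \<open>n\<close> during the loop; the truncated difference \<open>n - qi\<close> therefore
    really drops when a vertex is finished.\<close>
  have "?ql \<le> n"
    using I' card_image[of "N s ''q''" "{..<?ql}"] card_mono[of "{..<n}" "N s ''q'' ` {..<?ql}"]
    unfolding search_inv_def by simp
  show ?thesis
  proof (cases "?h x = 0")
    case True
    then have "run search_body s = nstore ''qi'' 0 (Suc ?qi) (nstore ''x'' 0 x s)"
      by (simp add: search_body_def x_def)
    then show ?thesis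
      using search_inv_next[OF I' b] True b \<open>?ql \<le> n\<close> by (simp add: search_state_def x_def)
  next
    case False
    have e_inc: "u e = x \<or> v e = x"
      using I' False unfolding search_inv_def e_def by blast
    have "e < m"
      using hm[of x] False by (simp add: e_def)
    then have "y < n"
      using uv(3) by (simp add: y_def)
    define s\<^sub>1 where "s\<^sub>1 = nstore ''y'' 0 y (nstore ''hd'' x (last_inc u v x e)
      (nstore ''e'' 0 e (nstore ''x'' 0 x s)))"
    have e_eq: "?h x - Suc 0 = e"
      by (simp add: e_def)
    have "run search_body s = (if N s ''vis'' y = 0
      then nstore ''ql'' 0 (Suc ?ql) (nstore ''pe'' ?ql e (nstore ''par'' ?ql ?qi
        (nstore ''q'' ?ql y (nstore ''vis'' y 1 s\<^sub>1)))) else s\<^sub>1)"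
      using False e_inc nx[OF \<open>e < m\<close>] uv(1,2)
      by (cases "u e = x") (auto simp: search_body_def s\<^sub>1_def x_def[symmetric] e_eq y_def)
    moreover have "card (darts u v (?h(x := last_inc u v x e))) < card (darts u v ?h)"
      using card_darts_pop[where h = ?h, OF hm False] e_inc by (simp add: e_def)
    ultimately show ?thesis
      using search_inv_skip[OF I' b x_def False e_def y_def \<open>y < n\<close>]
        search_inv_push[OF I' b x_def False e_def y_def \<open>y < n\<close>]
      by (simp add: search_state_def s\<^sub>1_def)
  qed
qed

text \<open>At the end the lists of all found vertices are exhausted, so the found set is closed
  under adjacency. That it is everything is a matter of connectedness, settled outside the
  program.\<close>

lemma exec_search:
  assumes n: "0 < n" and hd: "N s ''hd'' = (\<lambda>x. last_inc u v x m)"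
    and zero: "\<And>a. a \<in> {''q'', ''vis'', ''par'', ''qi''} \<Longrightarrow> N s a = (\<lambda>_. 0)"
    and uv: "N s ''u'' = u" "N s ''v'' = v" "\<And>e. e < m \<Longrightarrow> u e < n \<and> v e < n"
    and nx: "\<And>e. e < m \<Longrightarrow> N s ''nu'' e = last_inc u v (u e) e \<and> N s ''nv'' e = last_inc u v (v e) e"
  shows "\<exists>t s' k. exec search s t s' \<and>
    t \<le> cost search_init + Suc (cost search_body) * (n + 2 * m) + 1 \<and>
    0 < k \<and> N s' ''par'' 0 = 0 \<and> inj_on (N s' ''q'') {..<k} \<and> N s' ''q'' ` {..<k} \<subseteq> {..<n} \<and>
    (\<forall>i\<in>{1..<k}. N s' ''par'' i < i \<and> N s' ''pe'' i < m \<and>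
      {u (N s' ''pe'' i), v (N s' ''pe'' i)} = {N s' ''q'' i, N s' ''q'' (N s' ''par'' i)}) \<and>
    (\<forall>e<m. u e \<in> N s' ''q'' ` {..<k} \<longleftrightarrow> v e \<in> N s' ''q'' ` {..<k})"
proof -
  have "\<exists>t s'. exec search s t s' \<and>
    t \<le> cost search_init + Suc (cost search_body) * (n + 2 * m) + 1 \<and>
    search_state n m u v s' \<and> \<not> bval (NLess (nvar ''qi'') (nvar ''ql'')) s'"
    unfolding search_def
  proof (rule exec_phase[where f = "\<lambda>s'. n - N s' ''qi'' 0 + card (darts u v (N s' ''hd''))"])
    have "N (run search_init s) ''vis'' = (\<lambda>_. 0)(0 := 1)" "N (run search_init s) ''ql'' 0 = 1"
      "N (run search_init s) ''q'' = (\<lambda>_. 0)" "N (run search_init s) ''qi'' 0 = 0"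
      "N (run search_init s) ''par'' 0 = 0"
      "N (run search_init s) ''hd'' = (\<lambda>x. last_inc u v x m)"
      using zero hd by (simp_all add: search_init_def)
    then show "search_state n m u v (run search_init s)"
      using search_inv_init[OF n, of "N (run search_init s) ''par''"] by (simp add: search_state_def)
    show "n - N (run search_init s) ''qi'' 0 + card (darts u v (N (run search_init s) ''hd''))
      \<le> n + 2 * m"
      using card_darts[of "\<lambda>x. last_inc u v x m" m u v] last_inc_le zero hd
      by (simp add: search_init_def)
    fix s' assume fr: "frame search_body (run search_init s) s'" and I: "search_state n m u v s'"
      and b: "bval (NLess (nvar ''qi'') (nvar ''ql'')) s'"
    have "N s' ''u'' = u" "N s' ''v'' = v" "N s' ''nu'' = N s ''nu''" "N s' ''nv'' = N s ''nv''"
      using fr uv by (auto simp: frame_def search_body_def search_init_def)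
    then show "search_state n m u v (run search_body s') \<and>
      n - N (run search_body s') ''qi'' 0 + card (darts u v (N (run search_body s') ''hd'')) <
      n - N s' ''qi'' 0 + card (darts u v (N s' ''hd''))"
      using search_step[OF I _ _ _ uv(3)] nx b by simp
  qed (auto simp: search_init_def search_body_def)
  then obtain t s' where s': "exec search s t s'"
    "t \<le> cost search_init + Suc (cost search_body) * (n + 2 * m) + 1"
    "search_state n m u v s'" "N s' ''ql'' 0 \<le> N s' ''qi'' 0"
    by auto
  let ?k = "N s' ''ql'' 0"
  note I = s'(3)[unfolded search_state_def search_inv_def]
  have finished: "N s' ''hd'' (N s' ''q'' i) = 0" if "i < ?k" for i
    using I s'(4) that by (meson less_le_trans)
  have "u e \<in> N s' ''q'' ` {..<?k} \<longleftrightarrow> v e \<in> N s' ''q'' ` {..<?k}" if "e < m" for e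
  proof -
    have "u e \<in> N s' ''q'' ` {..<?k} \<and> v e \<in> N s' ''q'' ` {..<?k}"
      if "x \<in> N s' ''q'' ` {..<?k}" "u e = x \<or> v e = x" for x
    proof -
      have "N s' ''hd'' x \<le> e"
        using that(1) finished by auto
      then show ?thesis
        using I that \<open>e < m\<close> by blast
    qed
    then show ?thesis by blast
  qed
  then show ?thesis
    using s'(1,2) I by (intro exI[of _ t] exI[of _ s'] exI[of _ ?k]) auto
qed


section \<open>The dynamic program\<close>

text \<open>The invariant after the vertices with index at least \<open>i\<close> have been processed; \<open>D c\<close> is the
  gain of matching \<open>c\<close> with its parent.\<close>

definition dp_inv :: "nat \<Rightarrow> (nat \<Rightarrow> nat) \<Rightarrow> (nat \<Rightarrow> real) \<Rightarrow> nat \<Rightarrow> (nat \<Rightarrow> real) \<Rightarrow>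
    (nat \<Rightarrow> real) \<Rightarrow> (nat \<Rightarrow> real) \<Rightarrow> (nat \<Rightarrow> nat) \<Rightarrow> nat \<Rightarrow> bool" where
  "dp_inv n par wt i B P D mate r \<longleftrightarrow>
     (\<forall>v<n. B v = (\<Sum>c | c \<in> {i..<n} - {0} \<and> par c = v. P c)) \<and>
     (\<forall>c\<in>{i..<n} - {0}. D c = wt c + B c - P c) \<and>
     (\<forall>v<n. if mate v = 0 then \<forall>c\<in>{i..<n} - {0}. par c \<noteq> v
       else mate v \<in> {i..<n} - {0} \<and> par (mate v) = v \<and>
         (\<forall>c\<in>{i..<n} - {0}. par c = v \<longrightarrow> D c \<le> D (mate v))) \<and>
     (\<forall>v<i. P v = 0) \<and>
     (\<forall>v\<in>{i..<n}. P v =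
       (if mate v \<noteq> 0 \<and> 0 < B v + D (mate v) then B v + D (mate v) else 0)) \<and>
     r < n \<and> (\<forall>v<n. P v \<le> P r)"

text \<open>Index 0 is the root and nobody's child, so \<open>mate v = 0\<close> can stand for a
  vertex no child of which has been seen.\<close>

lemma dp_inv_init:
  assumes "0 < n"
  shows "dp_inv n par wt n (\<lambda>_. 0) (\<lambda>_. 0) D (\<lambda>_. 0) 0"
proof -
  have "{n..<n} - {0} = {}"
    by auto
  then show ?thesis
    using assms unfolding dp_inv_def by simp
qed

text \<open>Since \<open>mate v\<close> maximises \<open>D\<close> among the children of
  \<open>v\<close>, the inequality for it yields \<open>P_ge\<close> for all of them; a positive
  \<open>P v\<close> can only stem from the branch that uses \<open>mate v\<close>.\<close>

lemma dp_inv_solution: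
  assumes inv: "dp_inv n par wt 0 B P D mate r"
    and q: "inj_on q {..<n}" and par: "\<And>i. i \<in> {1..<n} \<Longrightarrow> par i < i"
  shows "dp_solution n q par wt P B mate r"
proof -
  have "{0..<n} - {0} = {1..<n}"
    by auto
  note inv' = inv[unfolded dp_inv_def this]
  have all: "\<forall>v<n. B v = (\<Sum>c | c \<in> {1..<n} \<and> par c = v. P c)"
    "\<forall>v<n. if mate v = 0 then \<forall>c\<in>{1..<n}. par c \<noteq> v
       else mate v \<in> {1..<n} \<and> par (mate v) = v \<and> (\<forall>c\<in>{1..<n}. par c = v \<longrightarrow> D c \<le> D (mate v))"
    "\<forall>v\<in>{0..<n}. P v = (if mate v \<noteq> 0 \<and> 0 < B v + D (mate v) then B v + D (mate v) else 0)"
    "r < n" "\<forall>v<n. P v \<le> P r"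
    by - (insert inv', elim conjE, assumption)+
  note B = all(1)[THEN spec, THEN mp] and mate = all(2)[THEN spec, THEN mp]
    and P = bspec[OF all(3), unfolded atLeastLessThan_iff, OF conjI[OF le0]] and r = all(5)[THEN spec, THEN mp]
  have D: "D c = wt c + B c - P c" if "c \<in> {1..<n}" for c
    using inv' that by blast
  have P_nonneg: "0 \<le> P v" if "v < n" for v
    using P[OF that] by simp
  show ?thesis
  proof (unfold_locales; (fact q par B P_nonneg)?)
    fix c assume c: "c \<in> {1..<n}"
    then have "par c < n"
      using par[OF c] by simp
    then have "mate (par c) \<noteq> 0" "D c \<le> D (mate (par c))"
      using mate[of "par c"] c by (auto split: if_splits)
    then have "B (par c) + D c \<le> P (par c)"
      using P[OF \<open>par c < n\<close>] by (auto split: if_splits)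
    then show "B (par c) + (wt c + B c - P c) \<le> P (par c)"
      using D[OF c] by simp
  next
    fix v assume v: "v < n" "0 < P v"
    then have nz: "mate v \<noteq> 0" and Pv: "P v = B v + D (mate v)"
      using P[of v] by (auto split: if_splits)
    then show "mate v \<in> {1..<n} \<and> par (mate v) = v \<and>
      P v = B v + (wt (mate v) + B (mate v) - P (mate v))"
      using mate[OF v(1)] D[of "mate v"] by simp
  qed (fact all(4), fact r)
qed

lemma sum_insert_child:
  assumes "0 < i" "i < n"
  shows "(\<Sum>c | c \<in> {i..<n} - {0} \<and> par c = v. f c :: real) =
    (\<Sum>c | c \<in> {Suc i..<n} - {0} \<and> par c = v. f c) + (if par i = v then f i else 0)"
proof -
  have "{c. c \<in> {i..<n} - {0} \<and> par c = v} = (if par i = v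
    then insert i {c. c \<in> {Suc i..<n} - {0} \<and> par c = v}
    else {c. c \<in> {Suc i..<n} - {0} \<and> par c = v})"
    using assms by (auto simp: Suc_le_eq le_less)
  then show ?thesis by simp
qed

text \<open>Children have larger indices than \<open>i\<close>, so \<open>B i\<close> and
  \<open>mate i\<close> are final when \<open>i\<close> is reached. Of these two arrays only the
  entries at \<open>par i < i\<close> change, which leaves the equations for \<open>P\<close> from
  \<open>i\<close> on intact.\<close>

lemma dp_inv_step:
  assumes inv: "dp_inv n par wt (Suc i) B P D mate r" and "i < n"
    and par: "i \<noteq> 0 \<longrightarrow> par i < i"
    and P': "P' = P(i := if mate i \<noteq> 0 \<and> 0 < B i + D (mate i) then B i + D (mate i) else 0)"
    and r': "r' = (if P' r < P' i then i else r)"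
    and B': "B' = (if i = 0 then B else B(par i := B (par i) + P' i))"
    and D': "D' = (if i = 0 then D else D(i := wt i + B i - P' i))"
    and mate': "mate' = (if i \<noteq> 0 \<and> (mate (par i) = 0 \<or> D' (mate (par i)) < D' i)
      then mate(par i := i) else mate)"
  shows "dp_inv n par wt i B' P' D' mate' r'"
proof -
  have B: "\<forall>v<n. B v = (\<Sum>c | c \<in> {Suc i..<n} - {0} \<and> par c = v. P c)"
    and D: "\<forall>c\<in>{Suc i..<n} - {0}. D c = wt c + B c - P c"
    and mate: "\<forall>v<n. if mate v = 0 then \<forall>c\<in>{Suc i..<n} - {0}. par c \<noteq> v
       else mate v \<in> {Suc i..<n} - {0} \<and> par (mate v) = v \<and>
         (\<forall>c\<in>{Suc i..<n} - {0}. par c = v \<longrightarrow> D c \<le> D (mate v))"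
    and P0: "\<forall>v<Suc i. P v = 0"
    and P: "\<forall>v\<in>{Suc i..<n}. P v =
       (if mate v \<noteq> 0 \<and> 0 < B v + D (mate v) then B v + D (mate v) else 0)"
    and r: "r < n" "\<forall>v<n. P v \<le> P r"
    using inv unfolding dp_inv_def by blast+
  have gt: "i < mate v" if "v < n" "mate v \<noteq> 0" for v
    using mate that by (auto simp: Suc_le_eq)
  have P'_same: "P' c = P c" if "c \<noteq> i" for c
    using that by (simp add: P')
  have B'_same: "B' c = B c" if "i \<le> c" for c
    using that par by (auto simp: B')
  have D'_same: "D' c = D c" if "c \<noteq> i" for c
    using that by (auto simp: D')
  have mate'_same: "mate' c = mate c" if "i \<le> c" for c
    using that par by (auto simp: mate')
  have sum_eq: "(\<Sum>c | c \<in> {Suc i..<n} - {0} \<and> par c = v. P' c) =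
      (\<Sum>c | c \<in> {Suc i..<n} - {0} \<and> par c = v. P c)" for v
    by (intro sum.cong) (auto simp: P'_same)
  have "\<forall>v<n. B' v = (\<Sum>c | c \<in> {i..<n} - {0} \<and> par c = v. P' c)"
  proof (cases "i = 0")
    case True
    moreover have "{0..<n} - {0} = {Suc 0..<n} - {0}"
      by auto
    ultimately show ?thesis
      using B sum_eq by (simp add: B')
  next
    case False
    then show ?thesis
      using B sum_eq sum_insert_child[where f = P' and par = par and i = i and n = n] \<open>i < n\<close> by (auto simp: B')
  qed
  moreover have "\<forall>c\<in>{i..<n} - {0}. D' c = wt c + B' c - P' c"
  proof
    fix c assume c: "c \<in> {i..<n} - {0}"
    show "D' c = wt c + B' c - P' c"
    proof (cases "c = i")
      case True
      then show ?thesis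
        using c B'_same[of i] by (simp add: D')
    next
      case False
      then show ?thesis
        using c D B'_same[of c] P'_same D'_same by auto
    qed
  qed
  moreover have "\<forall>v<n. if mate' v = 0 then \<forall>c\<in>{i..<n} - {0}. par c \<noteq> v
       else mate' v \<in> {i..<n} - {0} \<and> par (mate' v) = v \<and>
         (\<forall>c\<in>{i..<n} - {0}. par c = v \<longrightarrow> D' c \<le> D' (mate' v))"
  proof (cases "i = 0")
    case True
    then have "{i..<n} - {0} = {Suc i..<n} - {0}"
      by auto
    with mate show ?thesis
      by (simp only: mate' D' True) simp
  next
    case False
    have split: "{i..<n} - {0} = insert i ({Suc i..<n} - {0})"
      using False \<open>i < n\<close> by auto
    have D'_le: "c \<in> {Suc i..<n} - {0} \<Longrightarrow> D' c = D c" for c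
      using D'_same by simp
    show ?thesis
    proof (intro allI impI)
      fix v assume v: "v < n"
      note mv = mate[rule_format, OF v]
      show "if mate' v = 0 then \<forall>c\<in>{i..<n} - {0}. par c \<noteq> v
        else mate' v \<in> {i..<n} - {0} \<and> par (mate' v) = v \<and>
         (\<forall>c\<in>{i..<n} - {0}. par c = v \<longrightarrow> D' c \<le> D' (mate' v))"
      proof (cases "v = par i")
        case other: False
        then have "mate' v = mate v"
          by (simp add: mate')
        then show ?thesis
          using mv other D'_le unfolding split by (auto split: if_splits)
      next
        case v_eq: True
        show ?thesis
        proof (cases "mate v = 0 \<or> D' (mate v) < D' i")
          case True
          then have "mate' v = i"
            using v_eq False by (simp add: mate')
          moreover have "D' c \<le> D' i" if "c \<in> {Suc i..<n} - {0}" "par c = v" for c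
            using True mv that D'_le[of c] D'_le[of "mate v"] by (fastforce split: if_splits)
          ultimately show ?thesis
            using v_eq False unfolding split by auto
        next
          case keep: False
          then have "mate' v = mate v"
            using v_eq by (simp add: mate')
          then show ?thesis
            using mv keep D'_le unfolding split by (auto split: if_splits)
        qed
      qed
    qed
  qed
  moreover have "\<forall>v<i. P' v = 0"
    using P0 by (simp add: P')
  moreover have "\<forall>v\<in>{i..<n}. P' v =
       (if mate' v \<noteq> 0 \<and> 0 < B' v + D' (mate' v) then B' v + D' (mate' v) else 0)"
  proof
    fix v assume v: "v \<in> {i..<n}"
    have eq: "mate' v = mate v" "B' v = B v"
      using v mate'_same B'_same by auto
    have "D' (mate v) = D (mate v)" if "mate v \<noteq> 0"
      using gt[of v] that v D'_same[of "mate v"] by simp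
    moreover have "P' v = (if mate v \<noteq> 0 \<and> 0 < B v + D (mate v) then B v + D (mate v) else 0)"
    proof (cases "v = i")
      case True
      then show ?thesis by (simp add: P')
    next
      case False
      then show ?thesis
        using P v P'_same[OF False] by simp
    qed
    ultimately show "P' v =
       (if mate' v \<noteq> 0 \<and> 0 < B' v + D' (mate' v) then B' v + D' (mate' v) else 0)"
      unfolding eq by (cases "mate v = 0") simp_all
  qed
  moreover have "r' < n"
    using r \<open>i < n\<close> by (simp add: r')
  moreover have "\<forall>v<n. P' v \<le> P' r'"
  proof (intro allI impI)
    fix v assume v: "v < n"
    \<comment> \<open>Overwriting entry \<open>i\<close> replaces 0 by a nonnegative number, so the
      value at \<open>r\<close> cannot drop, even if \<open>r = i\<close>.\<close>
    have "P i = 0"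
      using P0 by simp
    moreover have "0 \<le> P' i"
      by (simp add: P')
    ultimately have "P r \<le> P' r"
      by (cases "r = i") (auto simp: P'_same)
    then have "P' v \<le> P' r" if "v \<noteq> i"
      using r(2) v that P'_same[OF that] by fastforce
    then show "P' v \<le> P' r'"
      by (cases "v = i") (auto simp: r')
  qed
  ultimately show ?thesis
    unfolding dp_inv_def by - (intro conjI; assumption)
qed

section \<open>The bottom-up pass as a program\<close>

definition dp_value :: com where
  "dp_value =
    Seq (NStore ''i'' (NConst 0) (NDec (nvar ''i'')))
   (Seq (If (Conj (Neg (NEq (NCell ''mate'' (nvar ''i'')) (NConst 0)))
          (RLess RZero (RAdd (RCell ''B'' (nvar ''i'')) (RCell ''D'' (NCell ''mate'' (nvar ''i''))))))
        (RStore ''P'' (nvar ''i'') (RAdd (RCell ''B'' (nvar ''i'')) (RCell ''D'' (NCell ''mate'' (nvar ''i'')))))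
        (RStore ''P'' (nvar ''i'') RZero))
   (If (RLess (RCell ''P'' (nvar ''r'')) (RCell ''P'' (nvar ''i'')))
        (NStore ''r'' (NConst 0) (nvar ''i'')) Skip))"

text \<open>The test for a better child is a disjunction; as conditions offer only conjunction and
  negation, its negation is tested and the branches are swapped.\<close>

definition dp_propagate :: com where
  "dp_propagate =
   If (NEq (nvar ''i'') (NConst 0)) Skip
     (Seq (RStore ''D'' (nvar ''i'') (RSub (RAdd (RCell ''w'' (NCell ''pe'' (nvar ''i'')))
            (RCell ''B'' (nvar ''i''))) (RCell ''P'' (nvar ''i''))))
     (Seq (RStore ''B'' (NCell ''par'' (nvar ''i''))
            (RAdd (RCell ''B'' (NCell ''par'' (nvar ''i''))) (RCell ''P'' (nvar ''i''))))
     (If (Conj (Neg (NEq (NCell ''mate'' (NCell ''par'' (nvar ''i''))) (NConst 0)))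
            (Neg (RLess (RCell ''D'' (NCell ''mate'' (NCell ''par'' (nvar ''i'')))) (RCell ''D'' (nvar ''i'')))))
        Skip
        (NStore ''mate'' (NCell ''par'' (nvar ''i'')) (nvar ''i'')))))"

definition dp_body :: com where
  "dp_body = Seq dp_value dp_propagate"

definition dp_init :: com where
  "dp_init = NStore ''i'' (NConst 0) (nvar ''vertices'')"

definition dp :: com where
  "dp = Seq dp_init (While (NLess (NConst 0) (nvar ''i'')) dp_body)"

lemma run_dp_value:
  fixes s :: state
  assumes "N s ''i'' 0 = Suc i"
  defines "s' \<equiv> run dp_value s"
  shows "N s' ''i'' 0 = i"
    "R s' ''P'' = (R s ''P'')(i := if N s ''mate'' i \<noteq> 0 \<and> 0 < R s ''B'' i + R s ''D'' (N s ''mate'' i)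
      then R s ''B'' i + R s ''D'' (N s ''mate'' i) else 0)"
    "N s' ''r'' 0 = (if R s' ''P'' (N s ''r'' 0) < R s' ''P'' i then i else N s ''r'' 0)"
  using assms(1) unfolding s'_def by (simp_all add: dp_value_def)

lemma run_dp_propagate:
  fixes s :: state
  assumes "N s ''i'' 0 = i"
  defines "s' \<equiv> run dp_propagate s"
  shows "R s' ''D'' = (if i = 0 then R s ''D''
      else (R s ''D'')(i := R s ''w'' (N s ''pe'' i) + R s ''B'' i - R s ''P'' i))"
    "R s' ''B'' = (if i = 0 then R s ''B''
      else (R s ''B'')(N s ''par'' i := R s ''B'' (N s ''par'' i) + R s ''P'' i))"
    "N s' ''mate'' = (if i \<noteq> 0 \<and>
      (N s ''mate'' (N s ''par'' i) = 0 \<or> R s' ''D'' (N s ''mate'' (N s ''par'' i)) < R s' ''D'' i)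
      then (N s ''mate'')(N s ''par'' i := i) else N s ''mate'')"
  using assms(1) unfolding s'_def by (simp_all add: dp_propagate_def)

lemma exec_dp:
  assumes n: "0 < n" "N s ''vertices'' 0 = n"
    and par: "N s ''par'' = par" "\<And>i. i \<in> {1..<n} \<Longrightarrow> par i < i"
    and wt: "wt = (\<lambda>i. R s ''w'' (N s ''pe'' i))" and q: "inj_on q {..<n}"
    and zero: "N s ''mate'' = (\<lambda>_. 0)" "N s ''r'' 0 = 0" "R s ''B'' = (\<lambda>_. 0)" "R s ''P'' = (\<lambda>_. 0)"
  shows "\<exists>t s'. exec dp s t s' \<and> t \<le> cost dp_init + Suc (cost dp_body) * n + 1 \<and>
    dp_solution n q par wt (R s' ''P'') (R s' ''B'') (N s' ''mate'') (N s' ''r'' 0)"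
proof -
  define I where "I s' \<longleftrightarrow> N s' ''i'' 0 \<le> n \<and> dp_inv n par wt (N s' ''i'' 0)
    (R s' ''B'') (R s' ''P'') (R s' ''D'') (N s' ''mate'') (N s' ''r'' 0)" for s' :: state
  have "\<exists>t s'. exec dp s t s' \<and> t \<le> cost dp_init + Suc (cost dp_body) * n + 1 \<and>
    I s' \<and> \<not> bval (NLess (NConst 0) (nvar ''i'')) s'"
    unfolding dp_def
  proof (rule exec_phase[where f = "\<lambda>s'. N s' ''i'' 0"])
    show "I (run dp_init s)"
      using dp_inv_init[OF n(1)] n zero by (simp add: I_def dp_init_def)
    show "N (run dp_init s) ''i'' 0 \<le> n"
      using n by (simp add: dp_init_def)
    fix s' assume fr: "frame dp_body (run dp_init s) s'" and I: "I s'"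
      and b: "bval (NLess (NConst 0) (nvar ''i'')) s'"
    have par': "N s' ''par'' = par" and wt': "wt = (\<lambda>i. R s' ''w'' (N s' ''pe'' i))"
      using fr par wt by (simp_all add: frame_def dp_body_def dp_value_def dp_propagate_def dp_init_def)
    from b obtain i where i: "N s' ''i'' 0 = Suc i"
      by (auto simp: gr0_conv_Suc)
    have "i < n" and inv: "dp_inv n par wt (Suc i)
      (R s' ''B'') (R s' ''P'') (R s' ''D'') (N s' ''mate'') (N s' ''r'' 0)"
      using I i by (simp_all add: I_def)
    have lt: "i \<noteq> 0 \<longrightarrow> par i < i"
      using par(2)[of i] \<open>i < n\<close> by simp
    define s\<^sub>1 where "s\<^sub>1 = run dp_value s'"
    define s\<^sub>2 where "s\<^sub>2 = run dp_propagate s\<^sub>1"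
    have s2: "run dp_body s' = s\<^sub>2"
      by (simp add: dp_body_def s\<^sub>1_def s\<^sub>2_def)
    note run\<^sub>1 = run_dp_value[OF i, folded s\<^sub>1_def]
    note run\<^sub>2 = run_dp_propagate[OF run\<^sub>1(1), folded s\<^sub>2_def]
    have fr1: "frame dp_value s' s\<^sub>1" and fr2: "frame dp_propagate s\<^sub>1 s\<^sub>2"
      using exec_loop_free exec_frame unfolding s\<^sub>1_def s\<^sub>2_def
      by (metis dp_value_def dp_propagate_def loop_free.simps)+
    have same: "N s\<^sub>1 ''mate'' = N s' ''mate''" "R s\<^sub>1 ''B'' = R s' ''B''" "R s\<^sub>1 ''D'' = R s' ''D''"
      "N s\<^sub>1 ''par'' = par" "R s\<^sub>1 ''w'' (N s\<^sub>1 ''pe'' i) = wt i"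
      using fr1 par' wt' by (simp_all add: frame_def dp_value_def)
    have same': "N s\<^sub>2 ''i'' 0 = i" "R s\<^sub>2 ''P'' = R s\<^sub>1 ''P''" "N s\<^sub>2 ''r'' 0 = N s\<^sub>1 ''r'' 0"
      using fr2 run\<^sub>1(1) by (simp_all add: frame_def dp_propagate_def)
    have "dp_inv n par wt i (R s\<^sub>2 ''B'') (R s\<^sub>2 ''P'') (R s\<^sub>2 ''D'') (N s\<^sub>2 ''mate'') (N s\<^sub>2 ''r'' 0)"
      by (rule dp_inv_step[OF inv \<open>i < n\<close> lt])
        (simp_all only: same' run\<^sub>1 run\<^sub>2[unfolded same])
    then show "I (run dp_body s') \<and> N (run dp_body s') ''i'' 0 < N s' ''i'' 0"
      using same'(1) i \<open>i < n\<close> by (simp add: I_def s2)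
  qed (auto simp: dp_init_def dp_body_def dp_value_def dp_propagate_def)
  then show ?thesis
    using dp_inv_solution[OF _ q par(2)] unfolding I_def by fastforce
qed


section \<open>The traceback\<close>

definition trace_body :: com where
  "trace_body =
    Seq (If (Conj (NEq (NCell ''st'' (NCell ''par'' (nvar ''j''))) (NConst 1))
              (NEq (NCell ''mate'' (NCell ''par'' (nvar ''j''))) (nvar ''j'')))
          (Seq (NStore ''st'' (nvar ''j'') (NConst 2))
               (NStore ''out'' (NCell ''pe'' (nvar ''j'')) (NConst 1)))
        (If (Conj (RLess RZero (RCell ''P'' (nvar ''j'')))
              (Neg (Conj (NEq (NCell ''st'' (NCell ''par'' (nvar ''j''))) (NConst 0))
                         (Neg (NEq (nvar ''j'') (nvar ''r''))))))
          (NStore ''st'' (nvar ''j'') (NConst 1)) Skip))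
   (NStore ''j'' (NConst 0) (NInc (nvar ''j'')))"

definition trace :: com where
  "trace = Seq Skip (While (NLess (nvar ''j'') (nvar ''vertices'')) trace_body)"

text \<open>The root needs no special treatment by the program: its own label is still 0 when
  it is inspected in place of the label of a parent.\<close>

definition trace_inv where
  "trace_inv n par pe P mate r st out j \<longleftrightarrow> j \<le> n \<and>
     (\<forall>i<j. st i = (if i \<noteq> 0 \<and> st (par i) = 1 \<and> mate (par i) = i then 2
       else if (0::real) < P i \<and> (i \<noteq> 0 \<and> st (par i) \<noteq> 0 \<or> i = r) then 1 else (0::nat))) \<and>
     (\<forall>i\<ge>j. st i = 0) \<and>
     (\<forall>e. out e = (1::nat) \<longleftrightarrow> (\<exists>i\<in>{1..<j}. st i = 2 \<and> pe i = e))"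

lemma trace_inv_step:
  assumes inv: "trace_inv n par pe P mate r st out j" and "j < n"
    and par: "\<And>i. i \<in> {1..<n} \<Longrightarrow> par i < i" "par 0 = 0"
    and st': "st' = st(j := if st (par j) = 1 \<and> mate (par j) = j then 2
       else if 0 < P j \<and> (st (par j) \<noteq> 0 \<or> j = r) then 1 else 0)"
    and out': "out' = (if st (par j) = 1 \<and> mate (par j) = j then out(pe j := 1) else out)"
  shows "trace_inv n par pe P mate r st' out' (Suc j)"
proof -
  have st0: "st i = 0" if "j \<le> i" for i
    using inv that by (simp add: trace_inv_def)
  \<comment> \<open>Parents of indices up to \<open>j\<close> lie below \<open>j\<close>, so
    labelling \<open>j\<close> does not disturb the equations established before.\<close>
  have same: "st' (par i) = st (par i)" if "i \<noteq> 0" "i \<le> j" for i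
    using par(1)[of i] that \<open>j < n\<close> by (simp add: st')
  have root: "j = 0 \<Longrightarrow> st (par j) = 0"
    using st0 par(2) by simp
  have "\<forall>i<Suc j. st' i = (if i \<noteq> 0 \<and> st' (par i) = 1 \<and> mate (par i) = i then 2
       else if 0 < P i \<and> (i \<noteq> 0 \<and> st' (par i) \<noteq> 0 \<or> i = r) then 1 else 0)"
  proof (intro allI impI)
    fix i assume "i < Suc j"
    then consider "i < j" | "i = j" by linarith
    then show "st' i = (if i \<noteq> 0 \<and> st' (par i) = 1 \<and> mate (par i) = i then 2
       else if 0 < P i \<and> (i \<noteq> 0 \<and> st' (par i) \<noteq> 0 \<or> i = r) then 1 else 0)"
    proof cases
      case 1
      then have "st' i = st i"
        by (simp add: st')
      then show ?thesis
        using inv 1 same[of i] unfolding trace_inv_def by (cases "i = 0") auto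
    next
      case 2
      then show ?thesis
        using root same[of j] by (cases "j = 0") (auto simp: st')
    qed
  qed
  moreover have "\<forall>i\<ge>Suc j. st' i = 0"
    using st0 by (simp add: st')
  moreover have "out' e = 1 \<longleftrightarrow> (\<exists>i\<in>{1..<Suc j}. st' i = 2 \<and> pe i = e)" for e
  proof -
    have out: "out e = 1 \<longleftrightarrow> (\<exists>i\<in>{1..<j}. st i = 2 \<and> pe i = e)"
      using inv by (simp add: trace_inv_def)
    have "(\<exists>i\<in>{1..<Suc j}. st' i = 2 \<and> pe i = e) \<longleftrightarrow>
        (\<exists>i\<in>{1..<j}. st i = 2 \<and> pe i = e) \<or> (j \<noteq> 0 \<and> st' j = 2 \<and> pe j = e)"
      by (auto simp: st' less_Suc_eq)
    moreover have "j \<noteq> 0 \<and> st' j = 2 \<longleftrightarrow> st (par j) = 1 \<and> mate (par j) = j"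
      using root by (cases "j = 0") (auto simp: st')
    ultimately show ?thesis
      using out by (auto simp: out')
  qed
  ultimately show ?thesis
    using \<open>j < n\<close> unfolding trace_inv_def by simp
qed

lemma exec_trace:
  assumes n: "N s ''vertices'' 0 = n"
    and par: "N s ''par'' = par" "\<And>i. i \<in> {1..<n} \<Longrightarrow> par i < i" "par 0 = 0"
    and zero: "N s ''j'' 0 = 0" "N s ''st'' = (\<lambda>_. 0)" "N s ''out'' = (\<lambda>_. 0)"
    and sol: "dp_solution n q par wt (R s ''P'') B (N s ''mate'') (N s ''r'' 0)"
  shows "\<exists>t s'. exec trace s t s' \<and> t \<le> cost Skip + Suc (cost trace_body) * n + 1 \<and>
    dp_solution.traceback n par (R s ''P'') (N s ''mate'') (N s ''r'' 0) (N s' ''st'') \<and>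
    (\<forall>e. N s' ''out'' e = 1 \<longleftrightarrow> (\<exists>i\<in>{1..<n}. N s' ''st'' i = 2 \<and> N s ''pe'' i = e))"
proof -
  define I where "I s' \<longleftrightarrow> trace_inv n par (N s ''pe'') (R s ''P'') (N s ''mate'') (N s ''r'' 0)
    (N s' ''st'') (N s' ''out'') (N s' ''j'' 0)" for s' :: state
  have "\<exists>t s'. exec trace s t s' \<and> t \<le> cost Skip + Suc (cost trace_body) * n + 1 \<and>
    I s' \<and> \<not> bval (NLess (nvar ''j'') (nvar ''vertices'')) s'"
    unfolding trace_def
  proof (rule exec_phase[where f = "\<lambda>s'. n - N s' ''j'' 0"])
    show "I (run Skip s)"
      using zero by (simp add: I_def trace_inv_def)
    fix s' assume fr: "frame trace_body (run Skip s) s'" and I: "I s'"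
      and b: "bval (NLess (nvar ''j'') (nvar ''vertices'')) s'"
    have const: "N s' ''par'' = par" "N s' ''vertices'' 0 = n" "N s' ''pe'' = N s ''pe''"
      "N s' ''mate'' = N s ''mate''" "N s' ''r'' = N s ''r''" "R s' ''P'' = R s ''P''"
      using fr par n by (simp_all add: frame_def trace_body_def)
    then have "N s' ''j'' 0 < n"
      using b by simp
    have "N s' ''st'' (N s' ''j'' 0) = 0"
      using I by (simp add: I_def trace_inv_def)
    then have st: "N (run trace_body s') ''st'' = (N s' ''st'')(N s' ''j'' 0 :=
        if N s' ''st'' (par (N s' ''j'' 0)) = 1 \<and> N s ''mate'' (par (N s' ''j'' 0)) = N s' ''j'' 0 then 2
        else if 0 < R s ''P'' (N s' ''j'' 0) \<and>
          (N s' ''st'' (par (N s' ''j'' 0)) \<noteq> 0 \<or> N s' ''j'' 0 = N s ''r'' 0) then 1 else 0)"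
      and out: "N (run trace_body s') ''out'' =
        (if N s' ''st'' (par (N s' ''j'' 0)) = 1 \<and> N s ''mate'' (par (N s' ''j'' 0)) = N s' ''j'' 0
         then (N s' ''out'')(N s ''pe'' (N s' ''j'' 0) := 1) else N s' ''out'')"
      and j: "N (run trace_body s') ''j'' 0 = Suc (N s' ''j'' 0)"
      using const by (auto simp: trace_body_def)
    show "I (run trace_body s') \<and> n - N (run trace_body s') ''j'' 0 < n - N s' ''j'' 0"
      using trace_inv_step[OF I[unfolded I_def] \<open>N s' ''j'' 0 < n\<close> par(2,3) st out] \<open>N s' ''j'' 0 < n\<close>
      by (simp add: I_def j)
  qed (auto simp: trace_body_def)
  then obtain t s' where s': "exec trace s t s'"
    "t \<le> cost Skip + Suc (cost trace_body) * n + 1" "I s'" "N s' ''vertices'' 0 \<le> N s' ''j'' 0"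
    by auto
  have "N s' ''vertices'' 0 = n"
    using exec_frame[OF s'(1)] n by (simp add: frame_def trace_def trace_body_def)
  then have "N s' ''j'' 0 = n"
    using s'(3,4) by (simp add: I_def trace_inv_def)
  with s'(3) have inv: "trace_inv n par (N s ''pe'') (R s ''P'') (N s ''mate'') (N s ''r'' 0)
      (N s' ''st'') (N s' ''out'') n"
    by (simp add: I_def)
  show ?thesis
  proof (intro exI conjI)
    show "dp_solution.traceback n par (R s ''P'') (N s ''mate'') (N s ''r'' 0) (N s' ''st'')"
      using inv unfolding dp_solution.traceback_def[OF sol] trace_inv_def by (elim conjE)
    show "\<forall>e. N s' ''out'' e = 1 \<longleftrightarrow> (\<exists>i\<in>{1..<n}. N s' ''st'' i = 2 \<and> N s ''pe'' i = e)"
      using inv unfolding trace_inv_def by (elim conjE)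
  qed (fact s'(1,2))+
qed


section \<open>The whole program\<close>

definition mwcm :: com where
  "mwcm = Seq build (Seq search (Seq dp trace))"

text \<open>The factors 1, 3, 1, 1 come from the bounds \<open>m\<close>, \<open>n + 2 * m\<close>,
  \<open>n\<close>, \<open>n\<close> on the rounds of the four loops, where
  \<open>m \<le> n\<close>.\<close>

definition mwcm_factor :: nat where
  "mwcm_factor =
    (cost Skip + Suc (cost build_body) * 1 + 1) + (cost search_init + Suc (cost search_body) * 3 + 1) +
    (cost dp_init + Suc (cost dp_body) * 1 + 1) + (cost Skip + Suc (cost trace_body) * 1 + 1)"

text \<open>Additive constants are absorbed because a tree has at least one vertex.\<close>

lemma affine_le_linear:
  fixes t a b k l n :: nat
  assumes "t \<le> a + b * k + 1" "k \<le> l * n" "1 \<le> n"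
  shows "t \<le> (a + b * l + 1) * n"
proof -
  have "b * k \<le> b * l * n"
    using mult_le_mono2[OF assms(2), of b] by (simp add: mult.assoc)
  moreover have "a + 1 \<le> (a + 1) * n"
    using mult_le_mono2[OF assms(3), of "a + 1"] by simp
  ultimately show ?thesis
    using assms(1) unfolding distrib_right by linarith
qed

lemma connected_closed:
  assumes conn: "connected_graph V E" and S: "S \<subseteq> V" "S \<noteq> {}"
    and closed: "\<And>x y. {x, y} \<in> E \<Longrightarrow> x \<in> S \<Longrightarrow> y \<in> S"
  shows "S = V"
proof (rule ccontr)
  assume "S \<noteq> V"
  then obtain a b where "a \<in> S" "b \<in> V - S"
    using S by blast
  then show False
    using connected_graph_exit[OF conn S(1)] closed by metis
qed

lemma mwcm_correct:
  fixes n :: nat and w :: "nat set \<Rightarrow> real"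
  assumes tree: "is_tree {..<n} E" and el: "edge_list E es"
  shows "\<exists>t s. exec mwcm (input_state n es w) t s \<and> t \<le> mwcm_factor * n \<and>
    max_weight_connected_matching E w (output_edges es s)"
proof -
  define m where "m = length es"
  define s\<^sub>0 where "s\<^sub>0 = input_state n es w"
  define u where "u = N s\<^sub>0 ''u''"
  define v where "v = N s\<^sub>0 ''v''"
  have sg: "simple_graph {..<n} E" and n: "0 < n" and conn: "connected_graph {..<n} E"
    using tree unfolding is_tree_def by (auto simp: lessThan_empty_iff)
  have card_E: "n = Suc (card E)" and fin_E: "finite E"
    using grown_card[OF tree_grown[OF tree]] by auto
  have "card E = m"
    using el distinct_card[of "map edge_of es"] by (simp add: edge_list_def m_def)
  then have m_le: "m \<le> n"
    using card_E by simp
  have edge: "edge_of (es ! e) = {u e, v e}" if "e < m" for e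
    using that by (simp add: u_def v_def s\<^sub>0_def input_state_def edge_of_def m_def)
  have E: "E = (\<lambda>e. {u e, v e}) ` {..<m}"
  proof -
    have "set es = (\<lambda>e. es ! e) ` {..<m}"
      by (auto simp: m_def set_conv_nth simp del: set_map)
    then have "E = (\<lambda>e. edge_of (es ! e)) ` {..<m}"
      using el by (simp add: edge_list_def image_image)
    then show ?thesis
      using edge by simp
  qed
  have uv_less: "u e < n \<and> v e < n" if "e < m" for e
    using simple_graph_edge[OF sg, of "u e" "v e"] E that by auto

  obtain t\<^sub>1 s\<^sub>1 where build: "exec build s\<^sub>0 t\<^sub>1 s\<^sub>1" "t\<^sub>1 \<le> cost Skip + Suc (cost build_body) * m + 1"
    "N s\<^sub>1 ''hd'' = (\<lambda>x. last_inc u v x m)"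
    "\<And>e. e < m \<Longrightarrow> N s\<^sub>1 ''nu'' e = last_inc u v (u e) e \<and> N s\<^sub>1 ''nv'' e = last_inc u v (v e) e"
    using exec_build[of s\<^sub>0 m u v] by (auto simp: s\<^sub>0_def u_def v_def m_def input_state_def)
  note fr\<^sub>1 = exec_frame[OF build(1)]
  have N\<^sub>1: "N s\<^sub>1 a = N s\<^sub>0 a" if "a \<notin> {''nu'', ''nv'', ''hd'', ''k''}" for a
    using fr\<^sub>1 that by (simp add: frame_def build_def build_body_def)
  have R\<^sub>1: "R s\<^sub>1 = R s\<^sub>0"
    using fr\<^sub>1 by (simp add: fun_eq_iff frame_def build_def build_body_def)

  have "N s\<^sub>1 a = (\<lambda>_. 0)" if "a \<in> {''q'', ''vis'', ''par'', ''qi''}" for a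
    using that N\<^sub>1[of a] by (auto simp: s\<^sub>0_def input_state_def)
  moreover have "N s\<^sub>1 ''u'' = u" "N s\<^sub>1 ''v'' = v"
    using N\<^sub>1 by (simp_all add: u_def v_def)
  ultimately obtain t\<^sub>2 s\<^sub>2 k where search: "exec search s\<^sub>1 t\<^sub>2 s\<^sub>2"
    "t\<^sub>2 \<le> cost search_init + Suc (cost search_body) * (n + 2 * m) + 1"
    "0 < k" "N s\<^sub>2 ''par'' 0 = 0" "inj_on (N s\<^sub>2 ''q'') {..<k}" "N s\<^sub>2 ''q'' ` {..<k} \<subseteq> {..<n}"
    "\<And>i. i \<in> {1..<k} \<Longrightarrow> N s\<^sub>2 ''par'' i < i \<and> N s\<^sub>2 ''pe'' i < m \<and>
      {u (N s\<^sub>2 ''pe'' i), v (N s\<^sub>2 ''pe'' i)} = {N s\<^sub>2 ''q'' i, N s\<^sub>2 ''q'' (N s\<^sub>2 ''par'' i)}"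
    "\<And>e. e < m \<Longrightarrow> u e \<in> N s\<^sub>2 ''q'' ` {..<k} \<longleftrightarrow> v e \<in> N s\<^sub>2 ''q'' ` {..<k}"
    using exec_search[OF n build(3) _ _ _ uv_less build(4)] by metis
  note fr\<^sub>2 = exec_frame[OF search(1)]
  have N\<^sub>2: "N s\<^sub>2 a = N s\<^sub>1 a"
    if "a \<notin> {''x'', ''e'', ''y'', ''hd'', ''vis'', ''q'', ''qi'', ''ql'', ''par'', ''pe''}" for a
    using fr\<^sub>2 that by (simp add: frame_def search_def search_init_def search_body_def)
  have R\<^sub>2: "R s\<^sub>2 = R s\<^sub>0"
    using fr\<^sub>2 R\<^sub>1 by (simp add: fun_eq_iff frame_def search_def search_init_def search_body_def)
  define q where "q = N s\<^sub>2 ''q''"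
  define par where "par = N s\<^sub>2 ''par''"
  define pe where "pe = N s\<^sub>2 ''pe''"
  note search' = search(3-8)[folded q_def par_def pe_def]
  \<comment> \<open>The found set is nonempty and closed under adjacency in a connected graph; hence
    the search reaches every vertex.\<close>
  have "q ` {..<k} = {..<n}"
  proof (rule connected_closed[OF conn search'(4)])
    show "q ` {..<k} \<noteq> {}"
      using search'(1) by auto
    fix x y assume xy: "{x, y} \<in> E" "x \<in> q ` {..<k}"
    then obtain e where "e < m" "{x, y} = {u e, v e}"
      using E by auto
    then show "y \<in> q ` {..<k}"
      using xy(2) search'(6) by (metis doubleton_eq_iff)
  qed
  then have "k = n"
    using card_image[OF search'(3)] by simp
  then have q: "inj_on q {..<n}" and par: "\<And>i. i \<in> {1..<n} \<Longrightarrow> par i < i"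
    and pe: "\<And>i. i \<in> {1..<n} \<Longrightarrow> pe i < m \<and> {u (pe i), v (pe i)} = {q i, q (par i)}"
    using search'(3,5) by auto
  interpret indexed_tree n q par
    using q par by unfold_locales
  have ed: "ed i = edge_of (es ! pe i)" if "i \<in> {1..<n}" for i
    using pe[OF that] edge by (simp add: ed_def)
  have "ed i \<in> E" if "i \<in> {1..<n}" for i
  proof -
    have "pe i < m"
      using pe[OF that] by blast
    then show ?thesis
      unfolding ed[OF that] E using edge by auto
  qed
  then have "ed ` {1..<n} \<subseteq> E"
    by blast
  \<comment> \<open>Here acyclicity pays off: the search tree has n - 1 distinct edges, as many as
    the whole tree, so no input edge is left over.\<close>
  moreover have "card (ed ` {1..<n}) = card E"
    using card_image[OF inj_ed] card_E by simp
  ultimately have E_ed: "ed ` {1..<n} = E"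
    using card_subset_eq[OF fin_E] by blast

  define wt where "wt = (\<lambda>i. R s\<^sub>2 ''w'' (N s\<^sub>2 ''pe'' i))"
  have wt: "w (ed i) = wt i" if "i \<in> {1..<n}" for i
    using pe[OF that] ed[OF that] R\<^sub>2
    by (simp add: wt_def pe_def s\<^sub>0_def input_state_def m_def)
  have "N s\<^sub>2 ''vertices'' 0 = n" "N s\<^sub>2 ''mate'' = (\<lambda>_. 0)" "N s\<^sub>2 ''r'' 0 = 0"
    "R s\<^sub>2 ''B'' = (\<lambda>_. 0)" "R s\<^sub>2 ''P'' = (\<lambda>_. 0)"
    using N\<^sub>2 N\<^sub>1 R\<^sub>2 by (simp_all add: s\<^sub>0_def input_state_def)
  then obtain t\<^sub>3 s\<^sub>3 where dp: "exec dp s\<^sub>2 t\<^sub>3 s\<^sub>3" "t\<^sub>3 \<le> cost dp_init + Suc (cost dp_body) * n + 1"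
    and sol: "dp_solution n q par wt (R s\<^sub>3 ''P'') (R s\<^sub>3 ''B'') (N s\<^sub>3 ''mate'') (N s\<^sub>3 ''r'' 0)"
    using exec_dp[OF n _ par_def[symmetric] par wt_def q] by blast
  note fr\<^sub>3 = exec_frame[OF dp(1)]
  have N\<^sub>3: "N s\<^sub>3 a = N s\<^sub>2 a" if "a \<notin> {''i'', ''r'', ''mate''}" for a
    using fr\<^sub>3 that by (simp add: frame_def dp_def dp_init_def dp_body_def dp_value_def dp_propagate_def)

  have "N s\<^sub>3 ''vertices'' 0 = n" "N s\<^sub>3 ''par'' = par" "N s\<^sub>3 ''j'' 0 = 0"
    "N s\<^sub>3 ''st'' = (\<lambda>_. 0)" "N s\<^sub>3 ''out'' = (\<lambda>_. 0)" and pe\<^sub>3: "N s\<^sub>3 ''pe'' = pe"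
    using N\<^sub>3 N\<^sub>2 N\<^sub>1 by (simp_all add: s\<^sub>0_def input_state_def par_def pe_def)
  then obtain t\<^sub>4 s\<^sub>4 where trace: "exec trace s\<^sub>3 t\<^sub>4 s\<^sub>4" "t\<^sub>4 \<le> cost Skip + Suc (cost trace_body) * n + 1"
    and tb: "dp_solution.traceback n par (R s\<^sub>3 ''P'') (N s\<^sub>3 ''mate'') (N s\<^sub>3 ''r'' 0) (N s\<^sub>4 ''st'')"
    and out: "\<And>e. N s\<^sub>4 ''out'' e = 1 \<longleftrightarrow> (\<exists>i\<in>{1..<n}. N s\<^sub>4 ''st'' i = 2 \<and> pe i = e)"
    using exec_trace[OF _ _ par search'(2) _ _ _ sol] by metis

  have "output_edges es s\<^sub>4 = ed ` {i \<in> {1..<n}. N s\<^sub>4 ''st'' i = 2}"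
  proof -
    have "output_edges es s\<^sub>4 = (\<lambda>i. edge_of (es ! pe i)) ` {i \<in> {1..<n}. N s\<^sub>4 ''st'' i = 2}"
      using pe unfolding output_edges_def out m_def by blast
    then show ?thesis
      using ed by simp
  qed
  then have "max_weight_connected_matching E w (output_edges es s\<^sub>4)"
    using dp_solution.traceback_optimal[OF sol tb, of w] wt E_ed by simp
  moreover have "exec mwcm s\<^sub>0 (t\<^sub>1 + (t\<^sub>2 + (t\<^sub>3 + t\<^sub>4))) s\<^sub>4"
    unfolding mwcm_def
    by (rule exec.Seq[OF build(1) exec.Seq[OF search(1) exec.Seq[OF dp(1) trace(1)]]])
  moreover have "t\<^sub>1 + (t\<^sub>2 + (t\<^sub>3 + t\<^sub>4)) \<le> mwcm_factor * n"
  proof -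
    have "m \<le> 1 * n" "n + 2 * m \<le> 3 * n" "n \<le> 1 * n" "1 \<le> n"
      using m_le n by auto
    note bound = affine_le_linear[OF build(2) this(1,4)] affine_le_linear[OF search(2) this(2,4)]
      affine_le_linear[OF dp(2) this(3,4)] affine_le_linear[OF trace(2) this(3,4)]
    show ?thesis
      unfolding mwcm_factor_def distrib_right[of _ _ n]
      using bound unfolding distrib_right[of _ _ n] by linarith
  qed
  ultimately show ?thesis
    unfolding s\<^sub>0_def by blast
qed

theorem theorem3:
  "\<exists>(p :: com) (c :: nat). \<forall>(n :: nat) (E :: nat set set) (w :: nat set \<Rightarrow> real) (es :: (nat \<times> nat) list).
     is_tree {..<n} E \<longrightarrow> edge_list E es \<longrightarrow>
     (\<exists>t s. exec p (input_state n es w) t s \<and> t \<le> c * n \<and>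
            max_weight_connected_matching E w (output_edges es s))"
  using mwcm_correct by blast

end
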